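(* Let $\nu_1\ne\nu_2$ be positive integers. For every $g\ge0$ and $(s_{2\nu_1},s_{2\nu_2})$ near $(0,0)$, the functions $e_g$ satisfy $$\begin{aligned}&\frac{\partial^2}{\partial w^2}\left[w^{2-2g}e_g(-w^{\nu_1-1}s_{2\nu_1},-w^{\nu_2-1}s_{2\nu_2})\right]\Big|_{w=1}\\&\quad=-\sum_{n=1}^g\frac2{(2n+2)!}\frac{\partial^{2n+2}}{\partial w^{2n+2}}\left[w^{2-2(g-n)}e_{g-n}(-w^{\nu_1-1}s_{2\nu_1},-w^{\nu_2-1}s_{2\nu_2})\right]\Big|_{w=1}\\&\qquad+\left(\text{the }k^{-2g}\text{ term of }\log\Bigl[\sum_{n=0}^\infty\frac1{k^{2n}}z_n(s_{2\nu_1},s_{2\nu_2})\Bigr]\right).\end{aligned}$$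
   Context: For $t_{2\nu_1},t_{2\nu_2}\ge0$ let $$Z_k(t_{2\nu_1},t_{2\nu_2})=\int_{\mathbb R^k}\exp\Bigl(-k\sum_{j=1}^k\bigl(\tfrac12\lambda_j^2+t_{2\nu_1}\lambda_j^{2\nu_1}+t_{2\nu_2}\lambda_j^{2\nu_2}\bigr)\Bigr)\prod_{j\ne\ell}|\lambda_j-\lambda_\ell|\,d^k\lambda .$$ As $k\to\infty$, $\log\bigl(Z_k(t_{2\nu_1},t_{2\nu_2})/Z_k(0,0)\bigr)=\sum_{g\ge0}k^{2-2g}e_g(t_{2\nu_1},t_{2\nu_2})$ asymptotically, with $e_g$ analytic near $(0,0)$. For $\xi_{2\nu_1},\xi_{2\nu_2}\le0$, $b_k>0$ are the recurrence coefficients $\lambda p_n=b_{n+1}p_{n+1}+b_np_{n-1}$ of the orthonormal polynomials for the weight $\exp(-\tfrac12\lambda^2+2\xi_{2\nu_1}\lambda^{2\nu_1}+2\xi_{2\nu_2}\lambda^{2\nu_2})\,d\lambda$ on $\mathbb R$. With $s_{2\nu_i}=2k^{\nu_i-1}\xi_{2\nu_i}$ fixed, $b_k^2\simeq k\sum_{g\ge0}k^{-2g}z_g(s_{2\nu_1},s_{2\nu_2})$ as $k\to\infty$, with $z_g$ analytic near $(0,0)$, $z_0(0,0)=1$, and $z_g(0,0)=0$ for $g\ge1$. The last term in the claim is the coefficient of $k^{-2g}$ of a formal series in $k^{-2}$. *)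

theory Defs
  imports
    "HOL-Analysis.Analysis"
    "HOL-Library.Landau_Symbols"
    "HOL-Computational_Algebra.Computational_Algebra"
begin

definition partition_fn :: "nat \<Rightarrow> nat \<Rightarrow> nat \<Rightarrow> real \<Rightarrow> real \<Rightarrow> real" where
  "partition_fn \<nu>1 \<nu>2 k t1 t2 =
     (\<integral>x. exp (- real k * (\<Sum>j<k. x j ^ 2 / 2 + t1 * x j ^ (2 * \<nu>1) + t2 * x j ^ (2 * \<nu>2))) *
          (\<Prod>(j, l) \<in> {(j, l). j < k \<and> l < k \<and> j \<noteq> l}. \<bar>x j - x l\<bar>)
        \<partial>(\<Pi>\<^sub>M j\<in>{..<k}. (lborel :: real measure)))"

definition weight :: "nat \<Rightarrow> nat \<Rightarrow> real \<Rightarrow> real \<Rightarrow> real \<Rightarrow> real" where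
  "weight \<nu>1 \<nu>2 \<xi>1 \<xi>2 x =
     exp (- (x ^ 2 / 2) + 2 * \<xi>1 * x ^ (2 * \<nu>1) + 2 * \<xi>2 * x ^ (2 * \<nu>2))"

text \<open>The Bochner form of the orthonormality relations includes the integrability of the
  products against the weight.\<close>

definition orthonormal_polys :: "(real \<Rightarrow> real) \<Rightarrow> (nat \<Rightarrow> real poly) \<Rightarrow> bool" where
  "orthonormal_polys w p \<longleftrightarrow>
     (\<forall>n. degree (p n) = n) \<and>
     (\<forall>m n. has_bochner_integral lborel (\<lambda>x. poly (p m) x * poly (p n) x * w x)
              (if m = n then 1 else 0))"

text \<open>The polynomials are fixed by degree and orthonormality up to a sign for each \<open>n\<close>;
  positivity of the \<open>b n\<close> leaves only a common sign free, which does not affect \<open>b\<close>.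
  The convention for \<open>n = 0\<close> is that the polynomial of index \<open>-1\<close> vanishes, so the value
  \<open>b 0\<close> is not constrained.\<close>

definition recurrence_coeffs :: "(real \<Rightarrow> real) \<Rightarrow> (nat \<Rightarrow> real) \<Rightarrow> bool" where
  "recurrence_coeffs w b \<longleftrightarrow>
     (\<forall>n>0. b n > 0) \<and>
     (\<exists>p. orthonormal_polys w p \<and>
        (\<forall>n. [:0, 1:] * p n =
               smult (b (n + 1)) (p (n + 1)) +
               (if n = 0 then 0 else smult (b n) (p (n - 1)))))"

text \<open>Asymptotic expansion \<open>f k \<sim> (\<Sum>g. a g * \<phi> g k)\<close> as \<open>k \<rightarrow> \<infinity>\<close> in the sense of
  Poincare; no convergence of the series is implied.\<close>

definition has_asymp_expansion ::
    "(nat \<Rightarrow> real) \<Rightarrow> (nat \<Rightarrow> nat \<Rightarrow> real) \<Rightarrow> (nat \<Rightarrow> real) \<Rightarrow> bool" where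
  "has_asymp_expansion f \<phi> a \<longleftrightarrow>
     (\<forall>N. (\<lambda>k. f k - (\<Sum>g\<le>N. a g * \<phi> g k)) \<in> o[sequentially](\<phi> N))"

text \<open>Real analyticity of a function of two variables near the origin: it is the sum of an
  (absolutely) convergent double power series on some neighbourhood of the origin.\<close>

definition analytic_near_0 :: "(real \<Rightarrow> real \<Rightarrow> real) \<Rightarrow> bool" where
  "analytic_near_0 f \<longleftrightarrow>
     (\<exists>r>0. \<exists>c :: nat \<Rightarrow> nat \<Rightarrow> real. \<forall>x y. \<bar>x\<bar> < r \<longrightarrow> \<bar>y\<bar> < r \<longrightarrow>
        ((\<lambda>(i, j). c i j * x ^ i * y ^ j) has_sum f x y) UNIV)"

text \<open>Logarithm of a formal power series with positive constant term \<open>a\<close>: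
  with \<open>F = a * (1 + G)\<close>, \<open>G\<close> without constant term, it is \<open>ln a\<close> plus the formal series of
  \<open>ln (1 + X)\<close>, which is \<open>fps_ln 1\<close>, composed with \<open>G\<close>.\<close>

definition fps_log :: "real fps \<Rightarrow> real fps" where
  "fps_log F =
     fps_const (ln (fps_nth F 0)) +
     fps_compose (fps_ln 1) (fps_const (1 / fps_nth F 0) * F - 1)"

end

theory Submission
  imports Defs "Jordan_Normal_Form.Determinant" "HOL-Complex_Analysis.Conformal_Mappings"
begin

text \<open>
  Heine's formula writes the partition function as a product of norms of orthogonal polynomials.
  With \<open>F j\<close> the logarithm of the normalised partition function at \<open>t = - (j/k)^(\<nu>-1) s\<close>, a choice
  for which the rescaled weight does not depend on \<open>j\<close>, this gives the Toda equation
  \<open>F (k+1) - 2 F k + F (k-1) = ln (b_k^2 / k)\<close> up to an error \<open>o(k^(-2g))\<close> for every \<open>g\<close>.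
  Inserting the expansion of \<open>F\<close> and expanding by Taylor in \<open>w = j/k = 1 \<plusminus> 1/k\<close>, the
  coefficients of \<open>k^(-2g)\<close> are the two sides of the claim.

  The expansion of \<open>F\<close> is assumed only pointwise in \<open>t\<close>, but here \<open>t\<close> moves with \<open>k\<close>. The partition
  function being continuous in \<open>t\<close>, Baire's theorem bounds the remainders uniformly on some open set
  of \<open>t\<close>. This yields the identity on an open set of \<open>s\<close>, in the form of polynomial relations between
  the \<open>z_n\<close> and the coefficients of their formal logarithm, and the identity theorem carries these to
  a neighbourhood of the origin.
\<close>

section \<open>Heine's formula and the Toda equation\<close>

text \<open>Asymptotic expansions cannot be differentiated term by term, so the second derivative in
  \<open>w\<close> has to come from a difference that the model satisfies exactly. The Taylor series
  of that difference, of which only even orders survive, is the source of the derivatives of order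
  \<open>2n+2\<close> in the claim. Division by the Gaussian partition function makes the right side
  of the exact equation \<open>ln (b_k^2) - ln (b_k(0)^2)\<close>; the values
  \<open>z_g(0,0)\<close> say that \<open>b_k(0)^2 / k\<close> is \<open>1\<close> to every order,
  and this is the origin of the error term. The expansion of the partition function reaches only
  \<open>t \<ge> 0\<close>, so the open set found by Baire's theorem sits inside the quadrant and
  away from the origin. For the continuation the logarithm is avoided: the relation is kept as
  \<open>z_0 = exp a_0\<close> with the recursion \<open>n z_n = sum i a_i z_(n-i)\<close>, which
  makes sense on a whole polydisc, and the first equation yields the positivity of
  \<open>z_0\<close> that the formal logarithm asks for. Each \<open>g\<close> involves finitely
  many functions, so a common polydisc exists for it.\<close>

lemma det_poly_values:
  fixes p :: "nat \<Rightarrow> real poly" and x :: "nat \<Rightarrow> real"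
  assumes deg: "\<And>i. degree (p i) = i"
  shows "Determinant.det (mat k k (\<lambda>(i, j). poly (p j) (x i))) =
    (\<Prod>i<k. lead_coeff (p i)) * (\<Prod>i<k. \<Prod>j<i. x i - x j)"
proof (induction k)
  case 0
  show ?case by simp
next
  case (Suc k)
  let ?A = "\<lambda>t. mat (Suc k) (Suc k) (\<lambda>(i, j). poly (p j) (if i = k then t else x i))"
  \<comment> \<open>Only row \<open>k\<close> depends on \<open>t\<close>, so its cofactors may be
    taken at \<open>t = 0\<close>. Expansion along this row makes the determinant a polynomial
    \<open>Q\<close> in the last node \<open>t\<close>.\<close>
  define C where "C j = cofactor (?A 0) k j" for j
  define Q where "Q = (\<Sum>j<Suc k. Polynomial.smult (C j) (p j))"
  have C: "cofactor (?A t) k j = C j" if "j < Suc k" for t j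
  proof -
    have "mat_delete (?A t) k j = mat_delete (?A 0) k j"
      unfolding mat_delete_def using that by (intro eq_matI) auto
    then show ?thesis by (simp add: C_def cofactor_def)
  qed
  have Q: "Determinant.det (?A t) = poly Q t" for t
    by (subst laplace_expansion_row[of _ "Suc k" k])
      (auto simp: Q_def poly_sum C mult.commute intro!: sum.cong)
  have Ck: "C k = (\<Prod>i<k. lead_coeff (p i)) * (\<Prod>i<k. \<Prod>j<i. x i - x j)"
  proof -
    have "mat_delete (?A 0) k k = mat k k (\<lambda>(i, j). poly (p j) (x i))"
      unfolding mat_delete_def by (intro eq_matI) auto
    then show ?thesis by (simp add: C_def cofactor_def Suc)
  qed
  have AA: "mat (Suc k) (Suc k) (\<lambda>(i, j). poly (p j) (x i)) = ?A (x k)"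
    by (intro eq_matI) auto
  show ?case
  \<comment> \<open>A repeated node makes both sides vanish. Distinct nodes are \<open>k\<close>
    different roots of \<open>Q\<close>, and these together with the coefficient of
    \<open>t^k\<close> determine it.\<close>
  proof (cases "inj_on x {..<k}")
    case False
    then obtain i j where ij: "i < k" "j < i" "x i = x j"
      unfolding inj_on_def by (metis lessThan_iff linorder_neqE_nat)
    have "(\<Prod>i<Suc k. \<Prod>j<i. x i - x j) = 0"
      using ij by (intro prod_zero bexI[of _ i] bexI[of _ j]) auto
    moreover have "Determinant.det (?A (x k)) = 0"
      by (rule det_identical_rows[of _ "Suc k" i j]) (use ij in \<open>auto intro!: eq_vecI\<close>)
    ultimately show ?thesis unfolding AA by simp
  next
    case True
    define R where "R = Polynomial.smult (C k * lead_coeff (p k)) (\<Prod>j<k. [:- x j, 1:])"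
    have degR: "degree (\<Prod>j<k. [:- x j, 1:]) = k"
      by (subst degree_prod_eq_sum_degree) auto
    have "lead_coeff (\<Prod>j<k. [:- x j, 1:]) = 1"
      by (simp only: lead_coeff_prod) simp
    then have cR: "Polynomial.coeff R k = C k * lead_coeff (p k)"
      using degR by (simp add: R_def)
    have cQ: "Polynomial.coeff Q k = C k * lead_coeff (p k)"
    proof -
      have "Polynomial.coeff Q k = (\<Sum>j<Suc k. C j * Polynomial.coeff (p j) k)" by (simp add: Q_def coeff_sum)
      also have "\<dots> = C k * Polynomial.coeff (p k) k"
        by (simp add: deg coeff_eq_0)
      finally show ?thesis by (simp add: deg)
    qed
    have "Q = R"
    proof (rule poly_eqI_degree_lead_coeff[where n = k and A = "x ` {..<k}"])
      show "Polynomial.coeff Q k = Polynomial.coeff R k" using cR cQ by simp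
      show "card (x ` {..<k}) \<ge> k" using True by (simp add: card_image)
      show "degree Q \<le> k" unfolding Q_def
        by (intro degree_sum_le) (auto simp: deg intro: order_trans[OF Polynomial.degree_smult_le])
      show "degree R \<le> k" unfolding R_def
        using degR degree_smult_le by metis
      fix z assume "z \<in> x ` {..<k}"
      then obtain i where i: "i < k" "z = x i" by auto
      have "poly R z = 0" using i by (auto simp: R_def poly_prod)
      moreover have "Determinant.det (?A z) = 0"
        by (rule det_identical_rows[of _ "Suc k" i k]) (use i in \<open>auto intro!: eq_vecI\<close>)
      ultimately show "poly Q z = poly R z" by (simp add: Q)
    qed
    then have "Determinant.det (?A (x k)) = C k * lead_coeff (p k) * (\<Prod>j<k. x k - x j)"
      unfolding Q by (simp add: R_def poly_prod)
    then show ?thesis unfolding AA Ck by simp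
  qed
qed

text \<open>The product runs over ordered pairs, so each unordered pair contributes its factor
  twice. Hence the integrand of \<open>partition_fn\<close> carries the square of the Vandermonde
  product.\<close>

lemma prod_offdiag_eq_square:
  fixes x :: "nat \<Rightarrow> real"
  shows "(\<Prod>(j, l) \<in> {(j, l). j < k \<and> l < k \<and> j \<noteq> l}. \<bar>x j - x l\<bar>) =
    (\<Prod>i<k. \<Prod>j<i. x i - x j)\<^sup>2"
proof -
  let ?L = "{(j, l). j < k \<and> l < j}" and ?U = "{(j, l). l < k \<and> j < l}"
  have fin: "finite ?L" "finite ?U"
    by (rule finite_subset[of _ "{..<k} \<times> {..<k}"]; auto)+
  have U: "{(j, l). j < k \<and> l < k \<and> j \<noteq> l} = ?L \<union> ?U" by auto
  have "(\<Prod>(j, l) \<in> {(j, l). j < k \<and> l < k \<and> j \<noteq> l}. \<bar>x j - x l\<bar>) =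
      (\<Prod>(j, l)\<in>?L. \<bar>x j - x l\<bar>) * (\<Prod>(j, l)\<in>?U. \<bar>x j - x l\<bar>)"
    unfolding U by (rule prod.union_disjoint) (use fin in auto)
  also have "(\<Prod>(j, l)\<in>?U. \<bar>x j - x l\<bar>) = (\<Prod>(j, l)\<in>?L. \<bar>x j - x l\<bar>)"
    by (rule prod.reindex_bij_witness[where i = prod.swap and j = prod.swap]) auto
  also have "(\<Prod>(j, l)\<in>?L. \<bar>x j - x l\<bar>) = \<bar>\<Prod>i<k. \<Prod>j<i. x i - x j\<bar>"
    by (subst prod.Sigma, simp, simp, subst abs_prod, rule prod.cong) auto
  finally show ?thesis by (simp add: power2_eq_square)
qed

lemma has_bochner_integral_Pi_lborel_prod:
  fixes f :: "nat \<Rightarrow> real \<Rightarrow> real"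
  assumes "\<And>i. i < k \<Longrightarrow> has_bochner_integral lborel (f i) (c i)"
  shows "has_bochner_integral (\<Pi>\<^sub>M i\<in>{..<k}. lborel) (\<lambda>x. \<Prod>i<k. f i (x i)) (\<Prod>i<k. c i)"
proof -
  interpret product_sigma_finite "\<lambda>i::nat. lborel :: real measure"
    by (rule product_sigma_finite.intro) (rule sigma_finite_lborel)
  show ?thesis
    using assms product_integrable_prod[of "{..<k}" f] product_integral_prod[of "{..<k}" f]
    by (simp add: has_bochner_integral_iff)
qed

text \<open>The degree condition alone still allows \<open>p 0 = 0\<close>, since the zero
  polynomial has degree \<open>0\<close>; the norm \<open>1\<close> excludes it.\<close>

lemma orthonormal_polys_lead_coeff:
  assumes "orthonormal_polys W p"
  shows "lead_coeff (p n) \<noteq> 0"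
proof
  assume "lead_coeff (p n) = 0"
  then have "has_bochner_integral lborel (\<lambda>x::real. 0::real) 1"
    using assms by (auto simp: orthonormal_polys_def dest!: spec[of _ n])
  then show False
    using has_bochner_integral_eq[OF _ has_bochner_integral_zero] by fastforce
qed

text \<open>Up to the leading coefficients the squared Vandermonde determinant is
  \<open>det (p j (x i))\<^sup>2\<close>; after expanding both determinants, only the pairs of equal
  permutations survive the integration.\<close>

lemma heine_formula:
  fixes W :: "real \<Rightarrow> real"
  assumes "orthonormal_polys W p"
  shows "has_bochner_integral (\<Pi>\<^sub>M j\<in>{..<k}. lborel)
    (\<lambda>x. (\<Prod>j<k. W (x j)) * (\<Prod>(j, l) \<in> {(j, l). j < k \<and> l < k \<and> j \<noteq> l}. \<bar>x j - x l\<bar>))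
    (fact k / (\<Prod>j<k. (lead_coeff (p j))\<^sup>2))"
proof -
  have deg: "degree (p n) = n" for n using assms by (simp add: orthonormal_polys_def)
  have orth: "has_bochner_integral lborel (\<lambda>x. poly (p m) x * poly (p n) x * W x)
      (if m = n then 1 else 0)" for m n
    using assms by (simp add: orthonormal_polys_def)
  define L where "L = (\<Prod>j<k. lead_coeff (p j))"
  have L: "L \<noteq> 0" using orthonormal_polys_lead_coeff[OF assms] by (simp add: L_def)
  let ?P = "{\<sigma>. \<sigma> permutes {..<k}}"
  define D where "D x = (\<Sum>\<sigma>\<in>?P. of_int (sign \<sigma>) * (\<Prod>i<k. poly (p (\<sigma> i)) (x i)))"
    for x :: "nat \<Rightarrow> real"
  have finP: "finite ?P" by (simp add: finite_permutations)
  have D: "D x = L * (\<Prod>i<k. \<Prod>j<i. x i - x j)" for x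
  proof -
    have "D x = Determinant.det (mat k k (\<lambda>(i, j). poly (p j) (x i)))"
      unfolding D_def
      by (subst det_def'[of _ k])
        (auto simp: lessThan_atLeast0 intro!: sum.cong prod.cong)
    then show ?thesis by (simp add: det_poly_values[OF deg] L_def)
  qed
  have DW: "(\<Prod>j<k. W (x j)) * (D x)\<^sup>2 = (\<Sum>\<sigma>\<in>?P. \<Sum>\<tau>\<in>?P. of_int (sign \<sigma> * sign \<tau>) *
      (\<Prod>i<k. poly (p (\<sigma> i)) (x i) * poly (p (\<tau> i)) (x i) * W (x i)))" for x
    unfolding D_def power2_eq_square sum_product
    by (simp add: sum_distrib_left prod.distrib mult_ac)
  have "has_bochner_integral (\<Pi>\<^sub>M j\<in>{..<k}. lborel) (\<lambda>x. (\<Prod>j<k. W (x j)) * (D x)\<^sup>2)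
     (\<Sum>\<sigma>\<in>?P. \<Sum>\<tau>\<in>?P. of_int (sign \<sigma> * sign \<tau>) * (\<Prod>i<k. if \<sigma> i = \<tau> i then 1 else 0))"
    unfolding DW
    by (intro has_bochner_integral_sum has_bochner_integral_mult_right
        has_bochner_integral_Pi_lborel_prod orth)
  also have "(\<Sum>\<sigma>\<in>?P. \<Sum>\<tau>\<in>?P. of_int (sign \<sigma> * sign \<tau>) *
      (\<Prod>i<k. if \<sigma> i = \<tau> i then 1 else 0)) = (\<Sum>\<sigma>\<in>?P. \<Sum>\<tau>\<in>?P. if \<tau> = \<sigma> then 1 else (0::real))"
  proof (intro sum.cong refl)
    fix \<sigma> \<tau> assume st: "\<sigma> \<in> ?P" "\<tau> \<in> ?P"
    show "of_int (sign \<sigma> * sign \<tau>) * (\<Prod>i<k. if \<sigma> i = \<tau> i then 1 else 0) =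
        (if \<tau> = \<sigma> then 1 else (0::real))"
    proof (cases "\<sigma> = \<tau>")
      case True
      then show ?thesis by (simp flip: of_int_mult)
    next
      case False
      then obtain i where "\<sigma> i \<noteq> \<tau> i" by auto
      moreover from this st have "i < k"
        by (metis lessThan_iff mem_Collect_eq permutes_not_in)
      ultimately show ?thesis using False by (auto intro!: prod_zero)
    qed
  qed
  also have "\<dots> = fact k"
    using finP card_permutations[of "{..<k}" k] by (simp add: sum.delta)
  finally have "has_bochner_integral (\<Pi>\<^sub>M j\<in>{..<k}. lborel)
      (\<lambda>x. (\<Prod>j<k. W (x j)) * (D x)\<^sup>2) (fact k)" .
  from has_bochner_integral_mult_right[OF this, of "1 / L\<^sup>2"] show ?thesis
    using L by (simp add: prod_offdiag_eq_square D power_mult_distrib L_def mult_ac prod_power_distrib)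
qed

section \<open>Rescaling, and the second difference of the logarithmic partition function\<close>

lemma orthonormal_polys_rescale:
  assumes "orthonormal_polys W p" "c > 0"
  shows "orthonormal_polys (\<lambda>x. W (c * x))
    (\<lambda>n. Polynomial.smult (sqrt c) (pcompose (p n) [:0, c:]))"
proof -
  have "has_bochner_integral lborel
     (\<lambda>x. sqrt c * poly (p m) (c * x) * (sqrt c * poly (p n) (c * x)) * W (c * x))
     (if m = n then 1 else 0)" for m n
  proof -
    have "has_bochner_integral lborel (\<lambda>x. poly (p m) x * poly (p n) x * W x)
        (if m = n then 1 else 0)"
      using assms(1) by (simp add: orthonormal_polys_def)
    then have "has_bochner_integral lborel
        (\<lambda>x. poly (p m) (0 + c * x) * poly (p n) (0 + c * x) * W (0 + c * x))
        ((if m = n then 1 else 0) /\<^sub>R \<bar>c\<bar>)"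
      using assms(2) lborel_has_bochner_integral_real_affine_iff[of c
        "\<lambda>x. poly (p m) x * poly (p n) x * W x" _ 0] by fastforce
    \<comment> \<open>The substitution divides the integral by \<open>c\<close>; a factor
      \<open>sqrt c\<close> on each of the two polynomials restores it.\<close>
    from has_bochner_integral_mult_right[OF this, of c] assms(2)
    have "has_bochner_integral lborel
        (\<lambda>x. c * (poly (p m) (c * x) * poly (p n) (c * x) * W (c * x))) (if m = n then 1 else 0)"
      by (simp split: if_splits)
    moreover have "sqrt c * u * (sqrt c * v) * w = c * (u * v * w)" for u v w
    proof -
      have "sqrt c * u * (sqrt c * v) * w = (sqrt c * sqrt c) * (u * v * w)" by simp
      then show ?thesis using assms(2) by simp
    qed
    ultimately show ?thesis by (simp only:)
  qed
  then show ?thesis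
    using assms by (auto simp: orthonormal_polys_def poly_pcompose degree_pcompose mult.commute[of _ c])
qed

text \<open>Heine's formula for the weight stretched by \<open>c = sqrt k\<close>: the power
  \<open>k^\<nu>\<close> produced by \<open>x^(2 \<nu>)\<close>, against the
  \<open>k^(\<nu> - 1)\<close> in \<xi>, leaves the common prefactor \<open>k\<close> of the
  exponent. The factors in the denominator are the leading coefficients of the stretched
  polynomials. The Bochner form matters, since the integral of a non-integrable function would
  default to \<open>0\<close>.\<close>

lemma partition_fn_integral:
  assumes "\<nu>1 > 0" "\<nu>2 > 0" "k > 0"
    and "orthonormal_polys (weight \<nu>1 \<nu>2 (- t1 / (2 * real k ^ (\<nu>1 - 1)))
      (- t2 / (2 * real k ^ (\<nu>2 - 1)))) p"
  shows "has_bochner_integral (\<Pi>\<^sub>M j\<in>{..<k}. lborel)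
     (\<lambda>x. exp (- real k * (\<Sum>j<k. x j ^ 2 / 2 + t1 * x j ^ (2 * \<nu>1) + t2 * x j ^ (2 * \<nu>2))) *
          (\<Prod>(j, l) \<in> {(j, l). j < k \<and> l < k \<and> j \<noteq> l}. \<bar>x j - x l\<bar>))
     (fact k / (\<Prod>j<k. (sqrt (sqrt k) * (lead_coeff (p j) * sqrt k ^ j))\<^sup>2))"
proof -
  let ?W = "weight \<nu>1 \<nu>2 (- t1 / (2 * real k ^ (\<nu>1 - 1))) (- t2 / (2 * real k ^ (\<nu>2 - 1)))"
  have pow: "real k ^ \<nu> / real k ^ (\<nu> - 1) = real k" if "\<nu> > 0" for \<nu>
    using assms(3) that by (cases \<nu>) auto
  have sq: "(sqrt (real k) * x) ^ (2 * \<nu>) = real k ^ \<nu> * x ^ (2 * \<nu>)" for x \<nu>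
    by (simp add: power_mult_distrib power_mult)
  have W: "?W (sqrt k * x) = exp (- real k * (x ^ 2 / 2 + t1 * x ^ (2 * \<nu>1) + t2 * x ^ (2 * \<nu>2)))" for x
  proof -
    have "- ((sqrt k * x)\<^sup>2 / 2) + 2 * (- t1 / (2 * real k ^ (\<nu>1 - 1))) * (sqrt k * x) ^ (2 * \<nu>1) +
        2 * (- t2 / (2 * real k ^ (\<nu>2 - 1))) * (sqrt k * x) ^ (2 * \<nu>2) =
      - (k * x\<^sup>2 / 2) - t1 * (real k ^ \<nu>1 / real k ^ (\<nu>1 - 1)) * x ^ (2 * \<nu>1)
        - t2 * (real k ^ \<nu>2 / real k ^ (\<nu>2 - 1)) * x ^ (2 * \<nu>2)"
      unfolding sq by (simp add: power_mult_distrib)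
    also have "\<dots> = - real k * (x ^ 2 / 2 + t1 * x ^ (2 * \<nu>1) + t2 * x ^ (2 * \<nu>2))"
      unfolding pow[OF assms(1)] pow[OF assms(2)] by (simp add: algebra_simps)
    finally show ?thesis unfolding weight_def by simp
  qed
  have prodW: "(\<Prod>j<k. ?W (sqrt k * x j)) =
      exp (- real k * (\<Sum>j<k. x j ^ 2 / 2 + t1 * x j ^ (2 * \<nu>1) + t2 * x j ^ (2 * \<nu>2)))" for x
    unfolding W by (simp add: exp_sum sum_distrib_left)
  have c: "sqrt k > 0" using assms(3) by simp
  have deg: "degree (p n) = n" for n using assms(4) by (simp add: orthonormal_polys_def)
  have lc: "lead_coeff (Polynomial.smult (sqrt (sqrt k)) (pcompose (p n) [:0, sqrt k:])) =
      sqrt (sqrt k) * (lead_coeff (p n) * sqrt k ^ n)" for n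
    using c by (subst lead_coeff_smult, subst lead_coeff_comp) (auto simp: deg)
  show ?thesis
    using heine_formula[OF orthonormal_polys_rescale[OF assms(4) c], of k]
    unfolding prodW lc .
qed

text \<open>Both sides of the recurrence are compared at \<open>x^(n+1)\<close>, a power that
  \<open>p (n - 1)\<close> does not reach.\<close>

lemma recurrence_coeffs_lead_coeff:
  assumes "orthonormal_polys W p"
    and "\<And>n. [:0, 1:] * p n = Polynomial.smult (b (n + 1)) (p (n + 1)) +
               (if n = 0 then 0 else Polynomial.smult (b n) (p (n - 1)))"
  shows "lead_coeff (p n) = b (Suc n) * lead_coeff (p (Suc n))"
proof -
  have deg: "degree (p n) = n" for n using assms by (simp add: orthonormal_polys_def)
  have "Polynomial.coeff (p (n - 1)) (Suc n) = 0" by (rule coeff_eq_0) (simp add: deg)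
  then show ?thesis
    using arg_cong[OF assms(2)[of n], of "\<lambda>q. Polynomial.coeff q (Suc n)"]
    by (auto simp: deg split: if_splits)
qed

text \<open>\<open>H \<xi>1 \<xi>2 j\<close> is the logarithm of the squared norm of the monic orthogonal polynomial of
  degree \<open>j\<close>. The arguments of \<open>partition_fn\<close> depend on \<open>k\<close> in such a way that, after the
  substitution \<open>x = sqrt k * y\<close>, the weight does not.\<close>

lemma ln_partition_fn_ratio:
  assumes "\<nu>1 > 0" "\<nu>2 > 0"
    and rec: "\<And>\<xi>1 \<xi>2. \<xi>1 \<le> 0 \<Longrightarrow> \<xi>2 \<le> 0 \<Longrightarrow> recurrence_coeffs (weight \<nu>1 \<nu>2 \<xi>1 \<xi>2) (b \<xi>1 \<xi>2)"
  obtains H :: "real \<Rightarrow> real \<Rightarrow> nat \<Rightarrow> real"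
  where "\<And>\<xi>1 \<xi>2 k. \<xi>1 \<le> 0 \<Longrightarrow> \<xi>2 \<le> 0 \<Longrightarrow> k > 0 \<Longrightarrow>
      ln (partition_fn \<nu>1 \<nu>2 k (- 2 * \<xi>1 * real k ^ (\<nu>1 - 1)) (- 2 * \<xi>2 * real k ^ (\<nu>2 - 1)) /
          partition_fn \<nu>1 \<nu>2 k 0 0) = (\<Sum>j<k. H \<xi>1 \<xi>2 j - H 0 0 j)"
    and "\<And>\<xi>1 \<xi>2 n. \<xi>1 \<le> 0 \<Longrightarrow> \<xi>2 \<le> 0 \<Longrightarrow> H \<xi>1 \<xi>2 (Suc n) - H \<xi>1 \<xi>2 n = ln ((b \<xi>1 \<xi>2 (Suc n))\<^sup>2)"
proof -
  have "\<forall>\<xi>1 \<xi>2. \<exists>p. \<xi>1 \<le> 0 \<longrightarrow> \<xi>2 \<le> 0 \<longrightarrow> orthonormal_polys (weight \<nu>1 \<nu>2 \<xi>1 \<xi>2) p \<and>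
      (\<forall>n. lead_coeff (p n) = b \<xi>1 \<xi>2 (Suc n) * lead_coeff (p (Suc n)))"
    using rec recurrence_coeffs_lead_coeff unfolding recurrence_coeffs_def by meson
  then obtain p where
    p: "\<And>\<xi>1 \<xi>2. \<xi>1 \<le> 0 \<Longrightarrow> \<xi>2 \<le> 0 \<Longrightarrow> orthonormal_polys (weight \<nu>1 \<nu>2 \<xi>1 \<xi>2) (p \<xi>1 \<xi>2)"
    and lcb: "\<And>\<xi>1 \<xi>2 n. \<xi>1 \<le> 0 \<Longrightarrow> \<xi>2 \<le> 0 \<Longrightarrow>
      lead_coeff (p \<xi>1 \<xi>2 n) = b \<xi>1 \<xi>2 (Suc n) * lead_coeff (p \<xi>1 \<xi>2 (Suc n))"
    by metis
  define H where "H \<xi>1 \<xi>2 j = - ln ((lead_coeff (p \<xi>1 \<xi>2 j))\<^sup>2)" for \<xi>1 \<xi>2 j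
  have lc: "(lead_coeff (p \<xi>1 \<xi>2 j))\<^sup>2 > 0" if "\<xi>1 \<le> 0" "\<xi>2 \<le> 0" for \<xi>1 \<xi>2 j
    using orthonormal_polys_lead_coeff[OF p[OF that]] by simp
  show thesis
  proof (rule that)
    fix \<xi>1 \<xi>2 :: real and k :: nat
    assume \<xi>: "\<xi>1 \<le> 0" "\<xi>2 \<le> 0" and k: "k > 0"
    let ?d = "\<lambda>j. sqrt (sqrt (real k)) * sqrt (real k) ^ j"
    have Z: "partition_fn \<nu>1 \<nu>2 k (- 2 * \<eta>1 * real k ^ (\<nu>1 - 1)) (- 2 * \<eta>2 * real k ^ (\<nu>2 - 1)) =
        fact k / ((\<Prod>j<k. (?d j)\<^sup>2) * (\<Prod>j<k. (lead_coeff (p \<eta>1 \<eta>2 j))\<^sup>2))"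
      if "\<eta>1 \<le> 0" "\<eta>2 \<le> 0" for \<eta>1 \<eta>2
      unfolding partition_fn_def prod.distrib[symmetric]
      by (subst has_bochner_integral_integral_eq[OF partition_fn_integral[where p = "p \<eta>1 \<eta>2"]])
        (use k p[OF that] assms(1,2) in \<open>auto simp: power_mult_distrib mult_ac\<close>)
    \<comment> \<open>The scaling factors \<open>?d j\<close> do not depend on \<xi> and cancel
      against those of the Gaussian case.\<close>
    have "(\<Prod>j<k. (?d j)\<^sup>2) > 0" using k by (intro prod_pos) auto
    then have "partition_fn \<nu>1 \<nu>2 k (- 2 * \<xi>1 * real k ^ (\<nu>1 - 1)) (- 2 * \<xi>2 * real k ^ (\<nu>2 - 1)) /
        partition_fn \<nu>1 \<nu>2 k 0 0 =
        (\<Prod>j<k. (lead_coeff (p 0 0 j))\<^sup>2 / (lead_coeff (p \<xi>1 \<xi>2 j))\<^sup>2)"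
      using Z[OF \<xi>] Z[of 0 0] by (simp add: prod_dividef)
    also have "ln \<dots> = (\<Sum>j<k. H \<xi>1 \<xi>2 j - H 0 0 j)"
      using lc[OF \<xi>] lc[of 0 0]
      by (subst ln_prod) (auto simp: H_def ln_div)
    finally show "ln (partition_fn \<nu>1 \<nu>2 k (- 2 * \<xi>1 * real k ^ (\<nu>1 - 1))
        (- 2 * \<xi>2 * real k ^ (\<nu>2 - 1)) / partition_fn \<nu>1 \<nu>2 k 0 0) = (\<Sum>j<k. H \<xi>1 \<xi>2 j - H 0 0 j)" .
  next
    fix \<xi>1 \<xi>2 :: real and n :: nat
    assume \<xi>: "\<xi>1 \<le> 0" "\<xi>2 \<le> 0"
    have "b \<xi>1 \<xi>2 (Suc n) > 0" using rec[OF \<xi>] by (auto simp: recurrence_coeffs_def)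
    then show "H \<xi>1 \<xi>2 (Suc n) - H \<xi>1 \<xi>2 n = ln ((b \<xi>1 \<xi>2 (Suc n))\<^sup>2)"
      using lc[OF \<xi>, of "Suc n"]
      by (simp add: H_def lcb[OF \<xi>, of n] power_mult_distrib ln_mult)
  qed
qed

text \<open>\<open>\<Phi> j\<close> is a sum over the degrees below \<open>j\<close>, so its second
  difference at \<open>k\<close> retains only the increment of \<open>H\<close> from
  \<open>k-1\<close> to \<open>k\<close>, which is \<open>ln (b_k^2)\<close>, and its Gaussian
  counterpart. The three partition functions have different arguments but the same \<xi>, hence the
  same polynomials. With \<open>k > 1\<close> the smallest size \<open>k - 1\<close> is still
  positive.\<close>

lemma second_difference_ln_partition_fn:
  assumes "\<nu>1 > 0" "\<nu>2 > 0"
    and rec: "\<And>\<xi>1 \<xi>2. \<xi>1 \<le> 0 \<Longrightarrow> \<xi>2 \<le> 0 \<Longrightarrow> recurrence_coeffs (weight \<nu>1 \<nu>2 \<xi>1 \<xi>2) (b \<xi>1 \<xi>2)"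
    and "\<xi>1 \<le> 0" "\<xi>2 \<le> 0" "k > 1"
  defines "\<Phi> \<equiv> \<lambda>j. ln (partition_fn \<nu>1 \<nu>2 j (- 2 * \<xi>1 * real j ^ (\<nu>1 - 1)) (- 2 * \<xi>2 * real j ^ (\<nu>2 - 1)) /
          partition_fn \<nu>1 \<nu>2 j 0 0)"
  shows "\<Phi> (k + 1) - 2 * \<Phi> k + \<Phi> (k - 1) = ln ((b \<xi>1 \<xi>2 k)\<^sup>2) - ln ((b 0 0 k)\<^sup>2)"
proof (rule ln_partition_fn_ratio[OF assms(1-3)])
  fix H
  assume H: "\<And>\<xi>1 \<xi>2 k. \<xi>1 \<le> 0 \<Longrightarrow> \<xi>2 \<le> 0 \<Longrightarrow> k > 0 \<Longrightarrow>
      ln (partition_fn \<nu>1 \<nu>2 k (- 2 * \<xi>1 * real k ^ (\<nu>1 - 1)) (- 2 * \<xi>2 * real k ^ (\<nu>2 - 1)) /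
          partition_fn \<nu>1 \<nu>2 k 0 0) = (\<Sum>j<k. H \<xi>1 \<xi>2 j - H 0 0 j)"
    "\<And>\<xi>1 \<xi>2 n. \<xi>1 \<le> 0 \<Longrightarrow> \<xi>2 \<le> 0 \<Longrightarrow> H \<xi>1 \<xi>2 (Suc n) - H \<xi>1 \<xi>2 n = ln ((b \<xi>1 \<xi>2 (Suc n))\<^sup>2)"
  obtain m where m: "k = Suc (Suc m)"
    using \<open>k > 1\<close> by (metis One_nat_def Suc_lessE less_imp_Suc_add)
  have "\<Phi> j = (\<Sum>i<j. H \<xi>1 \<xi>2 i - H 0 0 i)" if "j > 0" for j
    unfolding \<Phi>_def using H(1)[OF assms(4,5) that] .
  then show ?thesis
    using H(2)[OF assms(4,5), of "Suc m"] H(2)[of 0 0 "Suc m"] by (simp add: m)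
qed

text \<open>Dominated convergence with the integrand at \<open>t = 0\<close> as majorant: on the
  quadrant the even powers only lower the exponential. Integrability and positivity come from
  Heine's formula.\<close>

lemma continuous_on_ln_partition_fn_ratio:
  assumes "\<nu>1 > 0" "\<nu>2 > 0" "k > 0"
    and rec: "\<And>\<xi>1 \<xi>2. \<xi>1 \<le> 0 \<Longrightarrow> \<xi>2 \<le> 0 \<Longrightarrow> recurrence_coeffs (weight \<nu>1 \<nu>2 \<xi>1 \<xi>2) (b \<xi>1 \<xi>2)"
  shows "continuous_on ({0..} \<times> {0..})
    (\<lambda>(t1, t2). ln (partition_fn \<nu>1 \<nu>2 k t1 t2 / partition_fn \<nu>1 \<nu>2 k 0 0))"
proof -
  let ?M = "\<Pi>\<^sub>M j\<in>{..<k}. (lborel :: real measure)"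
  define f where "f t = (\<lambda>x. exp (- real k * (\<Sum>j<k. x j ^ 2 / 2 + fst t * x j ^ (2 * \<nu>1) + snd t * x j ^ (2 * \<nu>2))) *
          (\<Prod>(j, l) \<in> {(j, l). j < k \<and> l < k \<and> j \<noteq> l}. \<bar>x j - x l\<bar>))" for t :: "real \<times> real"
  have Z: "partition_fn \<nu>1 \<nu>2 k t1 t2 = integral\<^sup>L ?M (f (t1, t2))" for t1 t2
    by (simp add: partition_fn_def f_def)
  have int_pos: "integrable ?M (f t) \<and> integral\<^sup>L ?M (f t) > 0" if "t \<in> {0..} \<times> {0..}" for t
  proof -
    obtain t1 t2 where "t = (t1, t2)" by (rule prod.exhaust)
    with that have t: "t = (t1, t2)" "0 \<le> t1" "0 \<le> t2" by auto
    obtain p where p: "orthonormal_polys (weight \<nu>1 \<nu>2 (- t1 / (2 * real k ^ (\<nu>1 - 1)))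
      (- t2 / (2 * real k ^ (\<nu>2 - 1)))) p"
      using rec[of "- t1 / (2 * real k ^ (\<nu>1 - 1))" "- t2 / (2 * real k ^ (\<nu>2 - 1))"] t
      by (auto simp: recurrence_coeffs_def)
    have "0 < fact k / (\<Prod>j<k. (sqrt (sqrt k) * (lead_coeff (p j) * sqrt k ^ j))\<^sup>2)"
      using orthonormal_polys_lead_coeff[OF p] \<open>k > 0\<close> by (intro divide_pos_pos prod_pos) auto
    then show ?thesis
      using partition_fn_integral[OF assms(1-3) p] unfolding f_def t has_bochner_integral_iff by simp
  qed
  have "continuous_on ({0..} \<times> {0..}) (\<lambda>t. integral\<^sup>L ?M (f t))"
  proof (rule continuous_on_sequentiallyI)
    fix u :: "nat \<Rightarrow> real \<times> real" and a
    assume u: "\<forall>n. u n \<in> {0..} \<times> {0..}" "a \<in> {0..} \<times> {0..}" "u \<longlonglongrightarrow> a"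
    show "(\<lambda>n. integral\<^sup>L ?M (f (u n))) \<longlonglongrightarrow> integral\<^sup>L ?M (f a)"
    proof (rule integral_dominated_convergence[where w = "f 0"])
      show "f a \<in> borel_measurable ?M" "\<And>n. f (u n) \<in> borel_measurable ?M" "integrable ?M (f 0)"
        using int_pos[OF u(2)] int_pos[OF u(1)[rule_format]] int_pos[of 0]
        by (auto simp: zero_prod_def)
      show "AE x in ?M. (\<lambda>n. f (u n) x) \<longlonglongrightarrow> f a x"
        unfolding f_def by (intro AE_I2 tendsto_intros tendsto_fst tendsto_snd u)
      show "AE x in ?M. norm (f (u n) x) \<le> f 0 x" for n
      proof (rule AE_I2)
        fix x
        have "(\<Sum>j<k. x j ^ 2 / 2) \<le>
            (\<Sum>j<k. x j ^ 2 / 2 + fst (u n) * x j ^ (2 * \<nu>1) + snd (u n) * x j ^ (2 * \<nu>2))"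
          using u(1)[rule_format, of n]
          by (intro sum_mono) (auto simp: mem_Times_iff power_mult intro!: add_nonneg_nonneg mult_nonneg_nonneg)
        then show "norm (f (u n) x) \<le> f 0 x"
          unfolding f_def
          by (simp add: abs_mult abs_of_nonneg[OF prod_nonneg] case_prod_unfold)
            (auto intro!: mult_right_mono mult_left_mono prod_nonneg)
      qed
    qed
  qed
  then have "continuous_on ({0..} \<times> {0..}) (\<lambda>t. ln (integral\<^sup>L ?M (f t) / integral\<^sup>L ?M (f 0)))"
  proof (intro continuous_on_ln continuous_on_divide continuous_on_const ballI)
    have 0: "integral\<^sup>L ?M (f 0) > 0" using int_pos[of 0] by (simp add: zero_prod_def)
    then show "integral\<^sup>L ?M (f 0) \<noteq> 0" by simp
    show "integral\<^sup>L ?M (f t) / integral\<^sup>L ?M (f 0) \<noteq> 0" if "t \<in> {0..} \<times> {0..}" for t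
      using 0 int_pos[OF that] by simp
  qed
  then show ?thesis
    by (simp add: Z case_prod_unfold zero_prod_def)
qed

section \<open>Double power series and separately holomorphic functions\<close>

text \<open>The radius and the coefficients, hidden by quantifiers in
  \<open>analytic_near_0\<close>, are made explicit, so that several functions can share a polydisc
  and operators can act on the coefficients.\<close>

definition has_double_series :: "real \<Rightarrow> (nat \<Rightarrow> nat \<Rightarrow> real) \<Rightarrow> (real \<Rightarrow> real \<Rightarrow> real) \<Rightarrow> bool" where
  "has_double_series r c f \<longleftrightarrow> (\<forall>x y. \<bar>x\<bar> < r \<longrightarrow> \<bar>y\<bar> < r \<longrightarrow>
     ((\<lambda>(i, j). c i j * x ^ i * y ^ j) has_sum f x y) UNIV)"

lemma has_double_seriesD:
  assumes "has_double_series r c f" "\<bar>x\<bar> < r" "\<bar>y\<bar> < r"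
  shows "((\<lambda>(i, j). c i j * x ^ i * y ^ j) has_sum f x y) UNIV"
  using assms by (simp add: has_double_series_def)

lemma has_double_series_mono:
  "has_double_series r c f \<Longrightarrow> r' \<le> r \<Longrightarrow> has_double_series r' c f"
  by (auto simp: has_double_series_def)

text \<open>The functions \<open>e g\<close> are evaluated at \<open>- w^(\<nu>-1) s\<close>. Moving
  the signs into the coefficients leaves a plain dilation of the arguments, to which the Euler
  operator applies.\<close>

lemma has_double_series_reflect:
  assumes "has_double_series r c f"
  shows "has_double_series r (\<lambda>i j. (-1) ^ (i + j) * c i j) (\<lambda>x y. f (- x) (- y))"
  unfolding has_double_series_def
proof (intro allI impI)
  fix x y :: real
  assume "\<bar>x\<bar> < r" "\<bar>y\<bar> < r"
  then have "((\<lambda>(i, j). c i j * (- x) ^ i * (- y) ^ j) has_sum f (- x) (- y)) UNIV"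
    using has_double_seriesD[OF assms, of "- x" "- y"] by simp
  also have "(\<lambda>(i, j). c i j * (- x) ^ i * (- y) ^ j) =
      (\<lambda>(i, j). (-1) ^ (i + j) * c i j * x ^ i * y ^ j)"
    by (auto simp: power_minus[of x] power_minus[of y] power_add)
  finally show "((\<lambda>(i, j). (-1) ^ (i + j) * c i j * x ^ i * y ^ j) has_sum f (- x) (- y)) UNIV" .
qed

lemma analytic_near_0_imp_has_double_series:
  "analytic_near_0 f \<Longrightarrow> \<exists>r>0. \<exists>c. has_double_series r c f"
  unfolding analytic_near_0_def has_double_series_def by blast

lemma has_double_series_abs_summable:
  assumes "has_double_series r c f" "0 \<le> x" "x < r" "0 \<le> y" "y < r"
  shows "(\<lambda>(i, j). \<bar>c i j\<bar> * x ^ i * y ^ j) summable_on UNIV"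
proof -
  have "(\<lambda>(i, j). c i j * x ^ i * y ^ j) summable_on UNIV"
    using has_double_seriesD[OF assms(1), of x y] assms(2-) by (auto simp: summable_on_def)
  then have "(\<lambda>p. norm ((\<lambda>(i, j). c i j * x ^ i * y ^ j) p)) summable_on UNIV"
    by (rule iffD1[OF summable_on_iff_abs_summable_on_real])
  also have "(\<lambda>p. norm ((\<lambda>(i, j). c i j * x ^ i * y ^ j) p)) = (\<lambda>(i, j). \<bar>c i j\<bar> * x ^ i * y ^ j)"
    using assms by (auto simp: abs_mult)
  finally show ?thesis .
qed

lemma has_double_series_continuous_on:
  assumes "has_double_series r c f"
  shows "continuous_on ({- r<..<r} \<times> {- r<..<r}) (\<lambda>(x, y). f x y)"
proof (rule continuous_at_imp_continuous_on, rule ballI)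
  fix p :: "real \<times> real" assume "p \<in> {- r<..<r} \<times> {- r<..<r}"
  then obtain x y where p: "p = (x, y)" "\<bar>x\<bar> < r" "\<bar>y\<bar> < r" by auto
  \<comment> \<open>An intermediate radius: absolute summability at \<rho> dominates the series on a
    closed square around the point.\<close>
  obtain \<rho> where \<rho>: "max \<bar>x\<bar> \<bar>y\<bar> < \<rho>" "\<rho> < r"
    using p dense[of "max \<bar>x\<bar> \<bar>y\<bar>" r] by auto
  let ?K = "{- \<rho>..\<rho>} \<times> {- \<rho>..\<rho>}"
  have "uniform_limit ?K (\<lambda>X p. \<Sum>q\<in>X. (\<lambda>(i, j). c i j * fst p ^ i * snd p ^ j) q)
      (\<lambda>(x, y). f x y) (finite_subsets_at_top UNIV)"
  proof (rule Weierstrass_m_test_general'[where M = "\<lambda>(i, j). \<bar>c i j\<bar> * \<rho> ^ i * \<rho> ^ j"])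
    show "(\<lambda>(i, j). \<bar>c i j\<bar> * \<rho> ^ i * \<rho> ^ j) summable_on UNIV"
      using \<rho> by (intro has_double_series_abs_summable[OF assms]) auto
    show "norm (case q of (i, j) \<Rightarrow> c i j * fst p ^ i * snd p ^ j) \<le>
        (case q of (i, j) \<Rightarrow> \<bar>c i j\<bar> * \<rho> ^ i * \<rho> ^ j)" if "p \<in> ?K" for q p
      using that by (auto simp: abs_mult power_abs split: prod.split intro!: mult_mono power_mono)
    show "((\<lambda>q. case q of (i, j) \<Rightarrow> c i j * fst p ^ i * snd p ^ j) has_sum
        (case p of (x, y) \<Rightarrow> f x y)) UNIV" if "p \<in> ?K" for p
      using that \<rho> has_double_seriesD[OF assms, of "fst p" "snd p"] by (auto split: prod.split)
  qed
  then have "continuous_on ?K (\<lambda>(x, y). f x y)"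
    by (rule uniform_limit_theorem[rotated])
      (auto intro!: always_eventually continuous_on_sum continuous_on_mult continuous_on_power continuous_on_const
        continuous_on_fst continuous_on_snd continuous_on_id simp: case_prod_unfold)
  moreover have "p \<in> interior ?K"
    using p \<rho> by (auto simp: interior_Times)
  ultimately show "isCont (\<lambda>(x, y). f x y) p"
    using continuous_on_interior by blast
qed

lemma has_double_series_add:
  assumes "has_double_series r c f" "has_double_series r d g"
  shows "has_double_series r (\<lambda>i j. c i j + d i j) (\<lambda>x y. f x y + g x y)"
  unfolding has_double_series_def
proof (intro allI impI)
  fix x y :: real
  assume "\<bar>x\<bar> < r" "\<bar>y\<bar> < r"
  then show "((\<lambda>(i, j). (c i j + d i j) * x ^ i * y ^ j) has_sum f x y + g x y) UNIV"
    using has_sum_add[OF has_double_seriesD[OF assms(1)] has_double_seriesD[OF assms(2)], of x y x y]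
    by (simp add: case_prod_unfold algebra_simps)
qed

lemma has_double_series_cmult:
  assumes "has_double_series r c f"
  shows "has_double_series r (\<lambda>i j. k * c i j) (\<lambda>x y. k * f x y)"
  unfolding has_double_series_def
proof (intro allI impI)
  fix x y :: real
  assume "\<bar>x\<bar> < r" "\<bar>y\<bar> < r"
  then show "((\<lambda>(i, j). k * c i j * x ^ i * y ^ j) has_sum k * f x y) UNIV"
    using has_sum_cmult_right[OF has_double_seriesD[OF assms(1)], of x y k]
    by (simp add: case_prod_unfold algebra_simps)
qed

section \<open>Euler operator and derivatives along weighted dilations\<close>

lemma euler_coeff_abs_summable:
  assumes "has_double_series r c f" "0 \<le> x" "x < r" "0 \<le> y" "y < r"
  shows "(\<lambda>(i, j). \<bar>real (a * i + b * j) * c i j\<bar> * x ^ i * y ^ j) summable_on UNIV"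
proof -
  obtain \<rho> where \<rho>: "max x y < \<rho>" "\<rho> < r"
    using assms dense[of "max x y" r] by auto
  have pos: "\<rho> > 0" using assms \<rho> by auto
  define q where "q = max x y / \<rho>"
  have q: "0 \<le> q" "q < 1" using assms \<rho> pos by (auto simp: q_def)
  \<comment> \<open>The linear factor is paid for by moving out to \<rho>: it grows at most like a
    multiple of \<open>n = i + j\<close>, and \<open>n * q^n\<close> is bounded since
    \<open>q < 1\<close>. The radius \<open>r\<close> is therefore kept.\<close>
  have "(\<lambda>n. real n * q ^ n) \<longlonglongrightarrow> 0"
    using q powser_times_n_limit_0[of q] by simp
  then obtain K where K: "\<And>n. \<bar>real n * q ^ n\<bar> \<le> K"
    by (metis Bseq_def convergentI convergent_imp_Bseq real_norm_def)
  have xq: "x \<le> q * \<rho>" "y \<le> q * \<rho>" using pos by (auto simp: q_def)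
  have "(\<lambda>(i, j). (a + b) * K * (\<bar>c i j\<bar> * \<rho> ^ i * \<rho> ^ j)) summable_on UNIV"
    using summable_on_cmult_right[OF has_double_series_abs_summable[OF assms(1), of \<rho> \<rho>], of "(a + b) * K"]
      \<rho> pos by (simp add: case_prod_unfold)
  then show ?thesis
  proof (rule summable_on_comparison_test)
    fix p :: "nat \<times> nat"
    obtain i j where p: "p = (i, j)" by (cases p)
    have "x ^ i * y ^ j \<le> (q * \<rho>) ^ i * (q * \<rho>) ^ j"
      using assms xq q pos by (intro mult_mono power_mono) auto
    also have "\<dots> = q ^ (i + j) * (\<rho> ^ i * \<rho> ^ j)"
      by (simp add: power_mult_distrib power_add)
    finally have 1: "x ^ i * y ^ j \<le> q ^ (i + j) * (\<rho> ^ i * \<rho> ^ j)" .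
    have "a * i + b * j \<le> (a + b) * (i + j)" by (simp add: algebra_simps)
    then have 2: "real (a * i + b * j) \<le> real (a + b) * real (i + j)"
      by (metis of_nat_le_iff of_nat_mult)
    have "real (a * i + b * j) * (x ^ i * y ^ j) \<le>
        (real (a + b) * real (i + j)) * (q ^ (i + j) * (\<rho> ^ i * \<rho> ^ j))"
      using 1 2 assms q pos by (intro mult_mono[OF 2 1]) auto
    also have "\<dots> = real (a + b) * (real (i + j) * q ^ (i + j)) * (\<rho> ^ i * \<rho> ^ j)" by simp
    also have "\<dots> \<le> real (a + b) * K * (\<rho> ^ i * \<rho> ^ j)"
      using K[of "i + j"] pos by (intro mult_right_mono mult_left_mono) auto
    finally have "\<bar>c i j\<bar> * (real (a * i + b * j) * (x ^ i * y ^ j)) \<le>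
        \<bar>c i j\<bar> * (real (a + b) * K * (\<rho> ^ i * \<rho> ^ j))"
      by (rule mult_left_mono) simp
    then show "(case p of (i, j) \<Rightarrow> \<bar>real (a * i + b * j) * c i j\<bar> * x ^ i * y ^ j) \<le>
        (case p of (i, j) \<Rightarrow> (a + b) * K * (\<bar>c i j\<bar> * \<rho> ^ i * \<rho> ^ j))"
      by (simp add: p abs_mult mult_ac)
    show "0 \<le> (case p of (i, j) \<Rightarrow> \<bar>real (a * i + b * j) * c i j\<bar> * x ^ i * y ^ j)"
      using assms by (simp add: p)
  qed
qed

lemma has_double_series_euler:
  assumes "has_double_series r c f"
  shows "has_double_series r (\<lambda>i j. real (a * i + b * j) * c i j)
    (\<lambda>x y. \<Sum>\<^sub>\<infinity>(i, j). real (a * i + b * j) * c i j * x ^ i * y ^ j)"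
  unfolding has_double_series_def
proof (intro allI impI has_sum_infsum)
  fix x y :: real
  assume "\<bar>x\<bar> < r" "\<bar>y\<bar> < r"
  then have "(\<lambda>(i, j). \<bar>real (a * i + b * j) * c i j\<bar> * \<bar>x\<bar> ^ i * \<bar>y\<bar> ^ j) summable_on UNIV"
    by (intro euler_coeff_abs_summable[OF assms]) auto
  then show "(\<lambda>(i, j). real (a * i + b * j) * c i j * x ^ i * y ^ j) summable_on UNIV"
    by (subst summable_on_iff_abs_summable_on_real)
      (simp add: case_prod_unfold abs_mult power_abs)
qed

text \<open>The enumeration \<open>prod_decode\<close> turns the unordered double sum into an
  ordinary series, to which the theorem on termwise differentiation applies.\<close>

lemma has_double_series_sums:
  assumes "has_double_series r c f" "\<bar>x\<bar> < r" "\<bar>y\<bar> < r"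
  shows "(\<lambda>n. case prod_decode n of (i, j) \<Rightarrow> c i j * x ^ i * y ^ j) sums f x y"
  by (rule has_sum_imp_sums, subst has_sum_reindex_bij_betw[OF bij_prod_decode])
    (rule has_double_seriesD[OF assms])

text \<open>The Euler operator \<open>a x \<partial>/\<partial>x + b y \<partial>/\<partial>y\<close> is the derivative along
  \<open>w \<mapsto> (w^a x, w^b y)\<close>.\<close>

lemma has_double_series_euler_derivative:
  assumes f: "has_double_series r c f"
    and g: "has_double_series r (\<lambda>i j. real (a * i + b * j) * c i j) g"
    and w: "w > 0" "\<bar>w ^ a * x\<bar> < r" "\<bar>w ^ b * y\<bar> < r"
  shows "((\<lambda>w. f (w ^ a * x) (w ^ b * y)) has_field_derivative g (w ^ a * x) (w ^ b * y) / w) (at w)"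
proof -
  have "\<forall>\<^sub>F v in at w. \<bar>v ^ a * x\<bar> < r \<and> \<bar>v ^ b * y\<bar> < r \<and> v > 0"
    using w by (intro eventually_conj order_tendstoD(2)[of _ "\<bar>w ^ a * x\<bar>"]
      order_tendstoD(2)[of _ "\<bar>w ^ b * y\<bar>"] order_tendstoD(1)[of _ w]) (auto intro!: tendsto_intros)
  then obtain \<epsilon> where \<epsilon>: "\<epsilon> > 0"
    "\<And>v. v \<noteq> w \<Longrightarrow> dist v w < \<epsilon> \<Longrightarrow> \<bar>v ^ a * x\<bar> < r \<and> \<bar>v ^ b * y\<bar> < r \<and> v > 0"
    unfolding eventually_at by auto
  \<comment> \<open>On the interval from \<open>w1\<close> to \<open>w2\<close> the powers of
    \<open>v\<close> are largest at \<open>w2\<close> and \<open>1/v\<close> is largest at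
    \<open>w1\<close>, which gives the majorant \<open>?M\<close>.\<close>
  define w1 where "w1 = w - \<epsilon> / 2"
  define w2 where "w2 = w + \<epsilon> / 2"
  have w12: "w1 < w" "w < w2" using \<epsilon>(1) by (auto simp: w1_def w2_def)
  have w1: "w1 > 0" using \<epsilon>(2)[of w1] \<epsilon>(1) by (simp add: w1_def dist_real_def)
  have w2: "\<bar>w2 ^ a * x\<bar> < r" "\<bar>w2 ^ b * y\<bar> < r"
    using \<epsilon>(2)[of w2] \<epsilon>(1) by (simp_all add: w2_def dist_real_def)
  have bd: "\<bar>v ^ a * x\<bar> \<le> \<bar>w2 ^ a * x\<bar>" "\<bar>v ^ b * y\<bar> \<le> \<bar>w2 ^ b * y\<bar>" if "v \<in> {w1..w2}" for v
    using that w1 by (auto simp: abs_mult intro!: mult_right_mono power_mono)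
  let ?F = "\<lambda>n v. case prod_decode n of (i, j) \<Rightarrow> c i j * (v ^ a * x) ^ i * (v ^ b * y) ^ j"
  let ?F' = "\<lambda>n v. case prod_decode n of
      (i, j) \<Rightarrow> real (a * i + b * j) * c i j * (v ^ a * x) ^ i * (v ^ b * y) ^ j / v"
  let ?M = "\<lambda>n. case prod_decode n of
      (i, j) \<Rightarrow> \<bar>real (a * i + b * j) * c i j\<bar> * \<bar>w2 ^ a * x\<bar> ^ i * \<bar>w2 ^ b * y\<bar> ^ j / w1"
  have der: "(?F n has_field_derivative ?F' n v) (at v within {w1..w2})" if "v \<in> {w1..w2}" for n v
  proof -
    obtain i j where n: "prod_decode n = (i, j)" by fastforce
    have v: "v > 0" using that w1 by simp
    \<comment> \<open>At \<open>k = 0\<close> the truncated exponent \<open>k - 1\<close> is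
      harmless, as both sides vanish.\<close>
    have pow: "real k * v ^ (k - 1) = real k * v ^ k / v" for k
      using v by (cases k) auto
    have "((\<lambda>v. c i j * x ^ i * y ^ j * v ^ (a * i + b * j)) has_field_derivative
        c i j * x ^ i * y ^ j * (real (a * i + b * j) * v ^ (a * i + b * j - 1))) (at v within {w1..w2})"
      by (auto intro!: derivative_eq_intros)
    also have "(\<lambda>v. c i j * x ^ i * y ^ j * v ^ (a * i + b * j)) = ?F n"
      by (simp add: n power_mult_distrib power_add power_mult mult_ac)
    also have "c i j * x ^ i * y ^ j * (real (a * i + b * j) * v ^ (a * i + b * j - 1)) = ?F' n v"
      unfolding pow by (simp add: n power_mult_distrib power_add power_mult mult_ac del: of_nat_add of_nat_mult)
    finally show ?thesis .
  qed
  have "summable (\<lambda>n. case prod_decode n of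
      (i, j) \<Rightarrow> \<bar>real (a * i + b * j) * c i j\<bar> * \<bar>w2 ^ a * x\<bar> ^ i * \<bar>w2 ^ b * y\<bar> ^ j)"
  proof -
    have "(\<lambda>(i, j). \<bar>real (a * i + b * j) * c i j\<bar> * \<bar>w2 ^ a * x\<bar> ^ i * \<bar>w2 ^ b * y\<bar> ^ j) summable_on UNIV"
      using w2 by (intro euler_coeff_abs_summable[OF f]) auto
    then show ?thesis
      by (intro summable_on_imp_summable)
        (subst summable_on_reindex_bij_betw[OF bij_prod_decode])
  qed
  from summable_divide[OF this, of w1] have M: "summable ?M"
    by (simp add: case_prod_unfold)
  have "uniformly_convergent_on {w1..w2} (\<lambda>n v. \<Sum>i<n. ?F' i v)"
  proof (rule Weierstrass_m_test'[OF _ M])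
    fix n v assume v: "v \<in> {w1..w2}"
    obtain i j where n: "prod_decode n = (i, j)" by fastforce
    have "\<bar>real (a * i + b * j) * c i j\<bar> * \<bar>v ^ a * x\<bar> ^ i * \<bar>v ^ b * y\<bar> ^ j / \<bar>v\<bar> \<le>
      \<bar>real (a * i + b * j) * c i j\<bar> * \<bar>w2 ^ a * x\<bar> ^ i * \<bar>w2 ^ b * y\<bar> ^ j / w1"
      using bd[OF v] v w1 by (intro frac_le mult_mono power_mono order_refl mult_nonneg_nonneg) auto
    then show "norm (?F' n v) \<le> ?M n"
      by (simp add: n abs_mult power_abs)
  qed
  moreover have "summable (\<lambda>n. ?F n w)"
    using has_double_series_sums[OF f w(2,3)] by (simp add: sums_iff)
  ultimately have "((\<lambda>v. \<Sum>n. ?F n v) has_field_derivative (\<Sum>n. ?F' n w)) (at w)"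
    using der w12 by (intro has_field_derivative_series'(2)[where S = "{w1..w2}" and x0 = w])
      (auto simp: convex_real_interval)
  moreover have "(\<Sum>n. ?F' n w) = g (w ^ a * x) (w ^ b * y) / w"
    using sums_divide[OF has_double_series_sums[OF g w(2,3)], of w]
    by (simp add: sums_iff case_prod_unfold)
  ultimately have "((\<lambda>v. \<Sum>n. ?F n v) has_field_derivative g (w ^ a * x) (w ^ b * y) / w) (at w)"
    by simp
  then show ?thesis
  proof (rule has_field_derivative_transform_within_open)
    show "open {w1<..<w2}" "w \<in> {w1<..<w2}" using w12 by auto
    fix v assume "v \<in> {w1<..<w2}"
    then have "\<bar>v ^ a * x\<bar> < r" "\<bar>v ^ b * y\<bar> < r" using bd[of v] w2 by auto
    then show "(\<Sum>n. ?F n v) = f (v ^ a * x) (v ^ b * y)"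
      using has_double_series_sums[OF f] by (simp add: sums_iff)
  qed
qed

text \<open>The product rule gives \<open>w^(m-1)\<close> times the sum of \<open>m f\<close> and
  the Euler operator applied to \<open>f\<close>. Shape and radius survive and only the exponent is
  lowered, so the step can be iterated.\<close>

lemma has_double_series_power_int_derivative:
  assumes "has_double_series r c f"
  obtains d g where "has_double_series r d g"
    "\<And>w x y. w > 0 \<Longrightarrow> \<bar>w ^ a * x\<bar> < r \<Longrightarrow> \<bar>w ^ b * y\<bar> < r \<Longrightarrow>
      ((\<lambda>w. w powi m * f (w ^ a * x) (w ^ b * y)) has_field_derivative
        w powi (m - 1) * g (w ^ a * x) (w ^ b * y)) (at w)"
proof -
  obtain h where h: "has_double_series r (\<lambda>i j. real (a * i + b * j) * c i j) h"
    using has_double_series_euler[OF assms] by blast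
  show thesis
  proof (rule that[OF has_double_series_add[OF has_double_series_cmult[OF assms, of "of_int m"] h]])
    fix w x y :: real
    assume w: "w > 0" "\<bar>w ^ a * x\<bar> < r" "\<bar>w ^ b * y\<bar> < r"
    show "((\<lambda>w. w powi m * f (w ^ a * x) (w ^ b * y)) has_field_derivative
        w powi (m - 1) * (of_int m * f (w ^ a * x) (w ^ b * y) + h (w ^ a * x) (w ^ b * y))) (at w)"
    proof -
      have "((\<lambda>w. w powi m) has_field_derivative of_int m * w powi (m - 1)) (at w)"
        using w by (auto intro!: derivative_eq_intros)
      from DERIV_mult[OF this has_double_series_euler_derivative[OF assms h w]] show ?thesis
      proof (rule DERIV_cong)
        have "w powi m = w powi (m - 1) * w"
          using w power_int_add_1[of w "m - 1"] by simp
        then show "of_int m * w powi (m - 1) * f (w ^ a * x) (w ^ b * y) +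
            h (w ^ a * x) (w ^ b * y) / w * w powi m =
          w powi (m - 1) * (of_int m * f (w ^ a * x) (w ^ b * y) + h (w ^ a * x) (w ^ b * y))"
          using w by (simp add: algebra_simps)
      qed
    qed
  qed
qed

lemma has_double_series_iterated_derivative:
  assumes "has_double_series r c f"
  obtains g where "g 0 = f" "\<And>n. \<exists>d. has_double_series r d (g n)"
    "\<And>n w x y. w > 0 \<Longrightarrow> \<bar>w ^ a * x\<bar> < r \<Longrightarrow> \<bar>w ^ b * y\<bar> < r \<Longrightarrow>
      ((\<lambda>w. w powi (m - int n) * g n (w ^ a * x) (w ^ b * y)) has_field_derivative
        w powi (m - int (Suc n)) * g (Suc n) (w ^ a * x) (w ^ b * y)) (at w)"
proof -
  \<comment> \<open>Dependent choice fixes no starting point; the clause for \<open>n = 0\<close>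
    makes the sequence start at \<open>f\<close>.\<close>
  define P where "P n g \<longleftrightarrow> (\<exists>d. has_double_series r d g) \<and> (n = 0 \<longrightarrow> g = f)" for n :: nat and g
  define Q where "Q n g h \<longleftrightarrow>
      (\<forall>w x y. w > 0 \<longrightarrow> \<bar>w ^ a * x\<bar> < r \<longrightarrow> \<bar>w ^ b * y\<bar> < r \<longrightarrow>
      ((\<lambda>w. w powi (m - int n) * g (w ^ a * x) (w ^ b * y)) has_field_derivative
        w powi (m - int (Suc n)) * h (w ^ a * x) (w ^ b * y)) (at w))"
    for n and g h :: "real \<Rightarrow> real \<Rightarrow> real"
  have "\<exists>h. P (Suc n) h \<and> Q n g h" if P: "P n g" for n g
  proof -
    obtain d where d: "has_double_series r d g" using P by (auto simp: P_def)
    show ?thesis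
    proof (rule has_double_series_power_int_derivative[OF d, of a b "m - int n"])
      fix d' h
      assume h: "has_double_series r d' h"
        "\<And>w x y. w > 0 \<Longrightarrow> \<bar>w ^ a * x\<bar> < r \<Longrightarrow> \<bar>w ^ b * y\<bar> < r \<Longrightarrow>
          ((\<lambda>w. w powi (m - int n) * g (w ^ a * x) (w ^ b * y)) has_field_derivative
            w powi (m - int n - 1) * h (w ^ a * x) (w ^ b * y)) (at w)"
      have "m - int (Suc n) = m - int n - 1" by simp
      then have "Q n g h" using h(2) unfolding Q_def by presburger
      moreover have "P (Suc n) h" using h(1) by (auto simp: P_def)
      ultimately show ?thesis by blast
    qed
  qed
  moreover have "\<exists>g. P 0 g" using assms by (auto simp: P_def)
  ultimately obtain g where g: "\<And>n. P n (g n)" "\<And>n. Q n (g n) (g (Suc n))"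
    using dependent_nat_choice[of P Q] by blast
  show thesis
  proof (rule that)
    show "g 0 = f" "\<exists>d. has_double_series r d (g n)" for n
      using g(1)[of 0] g(1)[of n] by (auto simp: P_def)
    show "((\<lambda>w. w powi (m - int n) * g n (w ^ a * x) (w ^ b * y)) has_field_derivative
        w powi (m - int (Suc n)) * g (Suc n) (w ^ a * x) (w ^ b * y)) (at w)"
      if "w > 0" "\<bar>w ^ a * x\<bar> < r" "\<bar>w ^ b * y\<bar> < r" for n w x y
      using g(2)[of n] that by (auto simp: Q_def)
  qed
qed

text \<open>An iterate of \<open>deriv\<close> must be known on a neighbourhood before the next can
  be computed at a point, so the induction runs over the whole open set.\<close>

lemma funpow_deriv_eqI:
  fixes D :: "nat \<Rightarrow> real \<Rightarrow> real"
  assumes "open S" "w \<in> S" "\<And>n w. w \<in> S \<Longrightarrow> (D n has_field_derivative D (Suc n) w) (at w)"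
  shows "(deriv ^^ n) (D 0) w = D n w"
proof -
  have "\<forall>w\<in>S. (deriv ^^ n) (D 0) w = D n w"
  proof (induction n)
    case (Suc n)
    show ?case
    proof
      fix w assume w: "w \<in> S"
      have "((deriv ^^ n) (D 0) has_field_derivative D (Suc n) w) (at w)"
        by (rule has_field_derivative_transform_within_open[OF assms(3)[OF w] \<open>open S\<close> w])
          (use Suc in auto)
      then show "(deriv ^^ Suc n) (D 0) w = D (Suc n) w" by (simp add: DERIV_imp_deriv)
    qed
  qed auto
  then show ?thesis using assms(2) by blast
qed

text \<open>Real functions of two variables with an extension to a polydisc that is holomorphic in each
  variable separately; no joint regularity is needed for the identity theorem below.\<close>

definition sep_extension ::
    "real \<Rightarrow> (real \<Rightarrow> real \<Rightarrow> real) \<Rightarrow> (complex \<Rightarrow> complex \<Rightarrow> complex) \<Rightarrow> bool" where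
  "sep_extension r f F \<longleftrightarrow>
     (\<forall>y\<in>ball 0 r. (\<lambda>x. F x y) holomorphic_on ball 0 r) \<and>
     (\<forall>x\<in>ball 0 r. (\<lambda>y. F x y) holomorphic_on ball 0 r) \<and>
     (\<forall>x y. \<bar>x\<bar> < r \<longrightarrow> \<bar>y\<bar> < r \<longrightarrow> F (of_real x) (of_real y) = of_real (f x y))"

definition sep_holomorphic :: "real \<Rightarrow> (real \<Rightarrow> real \<Rightarrow> real) \<Rightarrow> bool" where
  "sep_holomorphic r f \<longleftrightarrow> (\<exists>F. sep_extension r f F)"

lemma double_series_holomorphic_fst:
  fixes F :: "complex \<Rightarrow> complex" and y :: complex
  assumes "\<And>x. norm x < r \<Longrightarrow> ((\<lambda>(i, j). complex_of_real (c i j) * x ^ i * y ^ j) has_sum F x) UNIV"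
  shows "F holomorphic_on ball 0 r"
proof (cases "r > 0")
  case True
  \<comment> \<open>Any positive number below \<open>r\<close> would do: summability at this real
    point gives, for fixed \<open>i\<close>, that of the inner series after division by
    \<open>\<rho>^i\<close>.\<close>
  define \<rho> where "\<rho> = r / 2"
  have \<rho>: "\<rho> > 0" "\<rho> < r" using True by (auto simp: \<rho>_def)
  have inner: "(\<lambda>j. complex_of_real (c i j) * y ^ j) summable_on UNIV" for i
  proof -
    have "(\<lambda>(i, j). complex_of_real (c i j) * of_real \<rho> ^ i * y ^ j) summable_on UNIV \<times> UNIV"
      using assms[of "of_real \<rho>"] \<rho> by (auto simp: summable_on_def)
    from summable_on_SigmaD1[OF this, of i]
    have "(\<lambda>j. of_real \<rho> ^ i * (complex_of_real (c i j) * y ^ j)) summable_on UNIV"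
      by (simp add: mult_ac)
    then show ?thesis
      using \<rho> by (subst (asm) summable_on_cmult_right') auto
  qed
  define A where "A i = (\<Sum>\<^sub>\<infinity>j. complex_of_real (c i j) * y ^ j)" for i
  have "(\<lambda>i. A i * (x - 0) ^ i) sums F x" if "x \<in> ball 0 r" for x
  proof -
    have "((\<lambda>i. A i * x ^ i) has_sum F x) UNIV"
    proof (rule has_sum_SigmaD)
      show "((\<lambda>(i, j). complex_of_real (c i j) * x ^ i * y ^ j) has_sum F x) (UNIV \<times> UNIV)"
        using assms[of x] that by simp
      show "((\<lambda>j. (case (i, j) of (i, j) \<Rightarrow> complex_of_real (c i j) * x ^ i * y ^ j)) has_sum A i * x ^ i) UNIV"
        for i
        using has_sum_cmult_left[OF has_sum_infsum[OF inner[of i]], of "x ^ i"]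
        by (simp add: A_def mult_ac)
    qed
    then show ?thesis using has_sum_imp_sums by fastforce
  qed
  then show ?thesis by (rule power_series_holomorphic)
next
  case False
  then have "ball (0 :: complex) r = {}" by simp
  then show ?thesis by (simp only: holomorphic_on_empty)
qed

lemma has_double_series_imp_sep_holomorphic:
  assumes f: "has_double_series r c f"
  shows "sep_holomorphic r f"
proof -
  define F where "F x y = (\<Sum>\<^sub>\<infinity>(i, j). complex_of_real (c i j) * x ^ i * y ^ j)" for x y :: complex
  have F: "((\<lambda>(i, j). complex_of_real (c i j) * x ^ i * y ^ j) has_sum F x y) UNIV"
    if "norm x < r" "norm y < r" for x y
    unfolding F_def
  proof (rule has_sum_infsum)
    have "(\<lambda>(i, j). \<bar>c i j\<bar> * norm x ^ i * norm y ^ j) summable_on UNIV"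
      using that by (intro has_double_series_abs_summable[OF f]) auto
    also have "(\<lambda>(i, j). \<bar>c i j\<bar> * norm x ^ i * norm y ^ j) =
        (\<lambda>p. norm ((\<lambda>(i, j). complex_of_real (c i j) * x ^ i * y ^ j) p))"
      by (auto simp: norm_mult norm_power)
    finally show "(\<lambda>(i, j). complex_of_real (c i j) * x ^ i * y ^ j) summable_on UNIV"
      by (rule abs_summable_summable)
  qed
  show ?thesis
    unfolding sep_holomorphic_def sep_extension_def
  proof (intro exI[of _ F] conjI ballI allI impI)
    fix y :: complex assume "y \<in> ball 0 r"
    then show "(\<lambda>x. F x y) holomorphic_on ball 0 r"
      using F by (intro double_series_holomorphic_fst[where c = c and y = y]) auto
  next
    fix x :: complex assume x: "x \<in> ball 0 r"
    show "F x holomorphic_on ball 0 r"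
    proof (rule double_series_holomorphic_fst[where c = "\<lambda>i j. c j i" and y = x])
      fix y :: complex assume "norm y < r"
      then have "((\<lambda>(i, j). complex_of_real (c i j) * x ^ i * y ^ j) has_sum F x y) (UNIV \<times> UNIV)"
        using F x by simp
      then show "((\<lambda>(i, j). complex_of_real (c j i) * y ^ i * x ^ j) has_sum F x y) UNIV"
        by (subst (asm) has_sum_swap) (simp add: mult_ac case_prod_unfold)
    qed
  next
    fix x y :: real assume "\<bar>x\<bar> < r" "\<bar>y\<bar> < r"
    then show "F (of_real x) (of_real y) = of_real (f x y)"
      using F[of "of_real x" "of_real y"] has_sum_of_real[OF has_double_seriesD[OF f], of x y, where 'a = complex]
      by (auto simp: case_prod_unfold intro: has_sum_unique)
  qed
qed

lemma sep_holomorphic_const: "sep_holomorphic r (\<lambda>_ _. k)"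
proof -
  have "sep_extension r (\<lambda>_ _. k) (\<lambda>_ _. of_real k)"
    by (simp add: sep_extension_def)
  then show ?thesis by (auto simp: sep_holomorphic_def)
qed

lemma sep_holomorphic_add:
  assumes "sep_holomorphic r f" "sep_holomorphic r g"
  shows "sep_holomorphic r (\<lambda>x y. f x y + g x y)"
proof -
  obtain F G where "sep_extension r f F" "sep_extension r g G"
    using assms by (auto simp: sep_holomorphic_def)
  then have "sep_extension r (\<lambda>x y. f x y + g x y) (\<lambda>x y. F x y + G x y)"
    unfolding sep_extension_def by (auto intro!: holomorphic_on_add)
  then show ?thesis by (auto simp: sep_holomorphic_def)
qed

lemma sep_holomorphic_mult:
  assumes "sep_holomorphic r f" "sep_holomorphic r g"
  shows "sep_holomorphic r (\<lambda>x y. f x y * g x y)"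
proof -
  obtain F G where "sep_extension r f F" "sep_extension r g G"
    using assms by (auto simp: sep_holomorphic_def)
  then have "sep_extension r (\<lambda>x y. f x y * g x y) (\<lambda>x y. F x y * G x y)"
    unfolding sep_extension_def by (auto intro!: holomorphic_on_mult)
  then show ?thesis by (auto simp: sep_holomorphic_def)
qed

lemma sep_holomorphic_exp:
  assumes "sep_holomorphic r f"
  shows "sep_holomorphic r (\<lambda>x y. exp (f x y))"
proof -
  obtain F where "sep_extension r f F"
    using assms by (auto simp: sep_holomorphic_def)
  then have "sep_extension r (\<lambda>x y. exp (f x y)) (\<lambda>x y. exp (F x y))"
    unfolding sep_extension_def by (auto intro!: holomorphic_on_compose[OF _ holomorphic_on_exp, unfolded o_def] simp: exp_of_real)
  then show ?thesis by (auto simp: sep_holomorphic_def)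
qed

lemma sep_holomorphic_sum:
  assumes "\<And>i. i \<in> I \<Longrightarrow> sep_holomorphic r (f i)"
  shows "sep_holomorphic r (\<lambda>x y. \<Sum>i\<in>I. f i x y)"
  using assms
proof (induction I rule: infinite_finite_induct)
  case (insert i I)
  then show ?case by (simp add: sep_holomorphic_add)
qed (auto intro: sep_holomorphic_const)

section \<open>Identity theorem, one variable at a time\<close>

lemma holomorphic_ball_eq_0:
  fixes h :: "complex \<Rightarrow> complex"
  assumes "h holomorphic_on ball 0 r" "{u<..<v} \<subseteq> {- r<..<r}" "u < v"
    and zero: "\<And>x. u < x \<Longrightarrow> x < v \<Longrightarrow> h (of_real x) = 0" and "norm x < r"
  shows "h x = 0"
proof (rule analytic_continuation[where f = h and S = "ball 0 r" and U = "complex_of_real ` {u<..<v}" and \<xi> = "of_real ((u + v) / 2)"])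
  have m: "u < (u + v) / 2" "(u + v) / 2 < v" using assms(3) by auto
  show "open (ball 0 r :: complex set)" "connected (ball 0 r :: complex set)" by auto
  show "complex_of_real ` {u<..<v} \<subseteq> ball 0 r"
    using assms(2) by (force simp: abs_less_iff)
  have "(u + v) / 2 \<in> {- r<..<r}" using m assms(2) by (meson greaterThanLessThan_iff subsetD)
  then show "complex_of_real ((u + v) / 2) \<in> ball 0 r"
    by (simp only: mem_ball dist_0_norm norm_of_real) (auto simp: abs_less_iff)
  show "complex_of_real ((u + v) / 2) islimpt complex_of_real ` {u<..<v}"
  proof (rule islimptI)
    fix T :: "complex set" assume T: "complex_of_real ((u + v) / 2) \<in> T" "open T"
    then obtain \<epsilon> where \<epsilon>: "\<epsilon> > 0" "ball (complex_of_real ((u + v) / 2)) \<epsilon> \<subseteq> T"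
      by (meson openE)
    \<comment> \<open>Half of the room left by the ball and by the interval around the midpoint, so
      that the shifted point lies in both.\<close>
    define d where "d = min (\<epsilon> / 2) ((v - u) / 4)"
    have d: "d > 0" "d < \<epsilon>" "d < (v - u) / 2" using \<epsilon>(1) assms(3) by (auto simp: d_def min_def)
    have "dist (complex_of_real ((u + v) / 2)) (complex_of_real ((u + v) / 2 + d)) = d"
      using d(1) by (simp add: dist_of_real dist_real_def del: of_real_add of_real_divide)
    then have "complex_of_real ((u + v) / 2 + d) \<in> T" using \<epsilon>(2) d(2) by auto
    moreover have "(u + v) / 2 + d \<in> {u<..<v}" using d m by (auto simp: field_simps)
    moreover have "complex_of_real ((u + v) / 2 + d) \<noteq> complex_of_real ((u + v) / 2)"
      using d(1) unfolding of_real_eq_iff by linarith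
    ultimately show "\<exists>y\<in>complex_of_real ` {u<..<v}. y \<in> T \<and> y \<noteq> complex_of_real ((u + v) / 2)"
      by blast
  qed
  show "\<And>z. z \<in> complex_of_real ` {u<..<v} \<Longrightarrow> h z = 0" using zero by auto
qed (use assms in auto)

lemma sep_holomorphic_eqI:
  assumes f: "sep_holomorphic r f" and g: "sep_holomorphic r g"
    and box: "{u1<..<v1} \<subseteq> {- r<..<r}" "u1 < v1" "{u2<..<v2} \<subseteq> {- r<..<r}" "u2 < v2"
    and eq: "\<And>x y. u1 < x \<Longrightarrow> x < v1 \<Longrightarrow> u2 < y \<Longrightarrow> y < v2 \<Longrightarrow> f x y = g x y"
    and xy: "\<bar>x\<bar> < r" "\<bar>y\<bar> < r"
  shows "f x y = g x y"
proof -
  have "sep_holomorphic r (\<lambda>x y. f x y + (-1) * g x y)"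
    by (intro sep_holomorphic_add sep_holomorphic_mult sep_holomorphic_const f g)
  then obtain F where "sep_extension r (\<lambda>x y. f x y + (-1) * g x y) F"
    by (auto simp: sep_holomorphic_def)
  then have F:
    "\<And>y. y \<in> ball 0 r \<Longrightarrow> (\<lambda>x. F x y) holomorphic_on ball 0 r"
    "\<And>x. x \<in> ball 0 r \<Longrightarrow> F x holomorphic_on ball 0 r"
    "\<And>x y. \<bar>x\<bar> < r \<Longrightarrow> \<bar>y\<bar> < r \<Longrightarrow> F (of_real x) (of_real y) = of_real (f x y + (-1) * g x y)"
    by (simp_all add: sep_extension_def)
  have real: "\<bar>x\<bar> < r" if "u < x" "x < v" "{u<..<v} \<subseteq> {- r<..<r}" for u v x
    proof -
    have "x \<in> {- r<..<r}" using that by (meson greaterThanLessThan_iff subsetD)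
    then show ?thesis by auto
  qed
  \<comment> \<open>For real \<open>x\<close> in the box, vanishing spreads from the interval in
    \<open>y\<close> to all real \<open>y\<close>; afterwards \<open>x\<close> is continued with
    \<open>y\<close> fixed. Each pass is a statement about one complex variable.\<close>
  have 1: "F (of_real x) (of_real y) = 0" if x: "u1 < x" "x < v1" and y: "\<bar>y\<bar> < r" for x y
  proof (rule holomorphic_ball_eq_0[OF F(2) box(3,4)])
    have xr: "\<bar>x\<bar> < r" using real[OF x box(1)] .
    then show "of_real x \<in> ball (0 :: complex) r" "norm (of_real y :: complex) < r" using y by simp_all
    show "F (of_real x) (of_real y') = 0" if "u2 < y'" "y' < v2" for y'
      by (subst F(3)[OF xr real[OF that box(3)]]) (simp add: eq[OF x that])
  qed
  have "F (of_real x) (of_real y) = 0"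
  proof (rule holomorphic_ball_eq_0[OF F(1) box(1,2)])
    show "of_real y \<in> ball (0 :: complex) r" "norm (of_real x :: complex) < r" using xy by simp_all
    show "F (of_real x') (of_real y) = 0" if "u1 < x'" "x' < v1" for x'
      using 1[OF that xy(2)] .
  qed
  then show ?thesis using F(3)[OF xy] by simp
qed

section \<open>Asymptotic expansions\<close>

lemma taylor_bound:
  fixes D :: "nat \<Rightarrow> real \<Rightarrow> real"
  assumes "\<eta> > 0"
    and der: "\<And>n w. w \<in> {c - \<eta>..c + \<eta>} \<Longrightarrow> (D n has_field_derivative D (Suc n) w) (at w)"
  obtains C where "\<And>\<epsilon>. \<bar>\<epsilon>\<bar> \<le> \<eta> \<Longrightarrow> \<bar>D 0 (c + \<epsilon>) - (\<Sum>m<n. D m c / fact m * \<epsilon> ^ m)\<bar> \<le> C * \<bar>\<epsilon>\<bar> ^ n"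
proof -
  have "continuous_on {c - \<eta>..c + \<eta>} (D n)"
    using der by (intro continuous_at_imp_continuous_on ballI DERIV_isCont)
  then have "bounded (D n ` {c - \<eta>..c + \<eta>})"
    by (intro compact_imp_bounded compact_continuous_image) auto
  then obtain K where K: "\<And>w. w \<in> {c - \<eta>..c + \<eta>} \<Longrightarrow> \<bar>D n w\<bar> \<le> K"
    unfolding bounded_iff by fastforce
  show thesis
  proof (rule that)
    fix \<epsilon> :: real assume \<epsilon>: "\<bar>\<epsilon>\<bar> \<le> \<eta>"
    have "\<exists>t\<in>{c - \<eta>..c + \<eta>}. D 0 (c + \<epsilon>) - (\<Sum>m<n. D m c / fact m * \<epsilon> ^ m) = D n t / fact n * \<epsilon> ^ n"
    \<comment> \<open>Taylor's formula with remainder is applied for \<open>n > 0\<close> and a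
      point other than the centre; otherwise \<open>t = c + \<epsilon>\<close> works at
      once.\<close>
    proof (cases "n = 0 \<or> \<epsilon> = 0")
      case True
      then show ?thesis
        using \<epsilon> assms(1)
        by (cases n) (auto intro!: bexI[of _ "c + \<epsilon>"] simp: lessThan_Suc_atMost sum.atMost_shift simp del: sum.lessThan_Suc sum.atMost_Suc)
    next
      case False
      then have "n > 0" by auto
      have D: "\<forall>m t. m < n \<and> c - \<eta> \<le> t \<and> t \<le> c + \<eta> \<longrightarrow> (D m has_field_derivative D (Suc m) t) (at t)"
        using der by auto
      from Taylor[OF \<open>n > 0\<close> refl D, of c "c + \<epsilon>"] False \<epsilon> assms(1)
      obtain t where t: "if c + \<epsilon> < c then c + \<epsilon> < t \<and> t < c else c < t \<and> t < c + \<epsilon>"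
        "D 0 (c + \<epsilon>) = (\<Sum>m<n. D m c / fact m * (c + \<epsilon> - c) ^ m) + D n t / fact n * (c + \<epsilon> - c) ^ n"
        by (auto simp: abs_le_iff)
      then have "t \<in> {c - \<eta>..c + \<eta>}" using \<epsilon> by (auto split: if_splits)
      then show ?thesis using t(2) by (intro bexI[of _ t]) auto
    qed
    then obtain t where t: "t \<in> {c - \<eta>..c + \<eta>}"
      "D 0 (c + \<epsilon>) - (\<Sum>m<n. D m c / fact m * \<epsilon> ^ m) = D n t / fact n * \<epsilon> ^ n" by blast
    have "\<bar>D n t / fact n * \<epsilon> ^ n\<bar> = \<bar>D n t\<bar> / fact n * \<bar>\<epsilon>\<bar> ^ n"
      by (simp add: abs_mult power_abs)
    also have "\<dots> \<le> K / fact n * \<bar>\<epsilon>\<bar> ^ n"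
      using K[OF t(1)] by (intro mult_right_mono divide_right_mono) auto
    finally show "\<bar>D 0 (c + \<epsilon>) - (\<Sum>m<n. D m c / fact m * \<epsilon> ^ m)\<bar> \<le> K / fact n * \<bar>\<epsilon>\<bar> ^ n"
      unfolding t(2) .
  qed
qed

text \<open>Odd powers cancel and even ones double. With Taylor coefficients for \<open>c\<close>,
  this is the source of the factor \<open>2/(2n+2)!\<close> in the claim.\<close>

lemma sum_even_part:
  fixes c :: "nat \<Rightarrow> real"
  shows "(\<Sum>m<2 * M + 2. c m * \<epsilon> ^ m) + (\<Sum>m<2 * M + 2. c m * (- \<epsilon>) ^ m) =
    2 * c 0 + (\<Sum>n<M. 2 * c (2 * n + 2) * \<epsilon> ^ (2 * n + 2))"
proof (induction M)
  case (Suc M)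
  have "2 * Suc M + 2 = Suc (Suc (2 * M + 2))" by simp
  then show ?case using Suc by (simp only: sum.lessThan_Suc) (simp add: algebra_simps)
qed (simp add: eval_nat_numeral)

lemma second_difference_taylor:
  fixes D :: "nat \<Rightarrow> real \<Rightarrow> real"
  assumes "\<eta> > 0"
    and der: "\<And>n w. w \<in> {c - \<eta>..c + \<eta>} \<Longrightarrow> (D n has_field_derivative D (Suc n) w) (at w)"
  obtains C where "C \<ge> 0" "\<And>\<epsilon>. 0 < \<epsilon> \<Longrightarrow> \<epsilon> \<le> \<eta> \<Longrightarrow>
    \<bar>D 0 (c + \<epsilon>) - 2 * D 0 c + D 0 (c - \<epsilon>) -
      (\<Sum>n<M. 2 / fact (2 * n + 2) * D (2 * n + 2) c * \<epsilon> ^ (2 * n + 2))\<bar> \<le> C * \<epsilon> ^ (2 * M + 2)"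
proof -
  obtain C where C: "\<And>\<epsilon>. \<bar>\<epsilon>\<bar> \<le> \<eta> \<Longrightarrow>
      \<bar>D 0 (c + \<epsilon>) - (\<Sum>m<2 * M + 2. D m c / fact m * \<epsilon> ^ m)\<bar> \<le> C * \<bar>\<epsilon>\<bar> ^ (2 * M + 2)"
    using taylor_bound[of \<eta> c D, OF assms(1) der] by blast
  \<comment> \<open>The bound at \<open>\<eta>\<close> itself excludes a negative constant; the sign
    is needed when a power of a small number is later weakened to a lower one.\<close>
  have C0: "C \<ge> 0"
  proof (rule ccontr)
    assume "\<not> C \<ge> 0"
    then have "C * \<bar>\<eta>\<bar> ^ (2 * M + 2) < 0" using assms(1) by (intro mult_neg_pos) auto
    then show False using order_trans[OF abs_ge_zero C[of \<eta>]] assms(1) by linarith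
  qed
  show thesis
  proof (rule that)
    show "2 * C \<ge> 0" using C0 by simp
    fix \<epsilon> :: real assume \<epsilon>: "0 < \<epsilon>" "\<epsilon> \<le> \<eta>"
    let ?S = "\<lambda>\<epsilon>. \<Sum>m<2 * M + 2. D m c / fact m * \<epsilon> ^ m"
    have "?S \<epsilon> + ?S (- \<epsilon>) = 2 * D 0 c +
        (\<Sum>n<M. 2 / fact (2 * n + 2) * D (2 * n + 2) c * \<epsilon> ^ (2 * n + 2))"
      using sum_even_part[of "\<lambda>m. D m c / fact m" \<epsilon> M] by simp
    then have "\<bar>D 0 (c + \<epsilon>) - 2 * D 0 c + D 0 (c - \<epsilon>) -
        (\<Sum>n<M. 2 / fact (2 * n + 2) * D (2 * n + 2) c * \<epsilon> ^ (2 * n + 2))\<bar> =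
      \<bar>(D 0 (c + \<epsilon>) - ?S \<epsilon>) + (D 0 (c - \<epsilon>) - ?S (- \<epsilon>))\<bar>"
      by (intro arg_cong[of _ _ abs]) linarith
    also have "\<dots> \<le> C * \<epsilon> ^ (2 * M + 2) + C * \<epsilon> ^ (2 * M + 2)"
      using \<epsilon> C[of \<epsilon>] C[of "- \<epsilon>"] by (intro order_trans[OF abs_triangle_ineq] add_mono) auto
    finally show "\<bar>D 0 (c + \<epsilon>) - 2 * D 0 c + D 0 (c - \<epsilon>) -
        (\<Sum>n<M. 2 / fact (2 * n + 2) * D (2 * n + 2) c * \<epsilon> ^ (2 * n + 2))\<bar> \<le> 2 * C * \<epsilon> ^ (2 * M + 2)"
      by simp
  qed
qed

text \<open>The square of indices splits into the triangle \<open>h + n \<le> g\<close>, whose terms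
  collect into the convolution coefficients, and a rest in which every power is at least
  \<open>g + 1\<close>. Since \<open>g \<le> N\<close>, the triangle lies in the square.\<close>

lemma triangle_truncation_bound:
  fixes \<beta> :: "nat \<Rightarrow> nat \<Rightarrow> real"
  assumes "g \<le> N"
  obtains C where "\<And>x. 0 \<le> x \<Longrightarrow> x \<le> 1 \<Longrightarrow>
    \<bar>(\<Sum>h\<le>N. \<Sum>n\<le>N. \<beta> h n * x ^ (h + n)) - (\<Sum>q\<le>g. (\<Sum>n\<le>q. \<beta> (q - n) n) * x ^ q)\<bar> \<le> C * x ^ (g + 1)"
proof (rule that)
  fix x :: real assume x: "0 \<le> x" "x \<le> 1"
  let ?T = "{(n, h). n + h \<le> g}"
  let ?R = "{..N} \<times> {..N} - ?T"
  have T: "?T \<subseteq> {..N} \<times> {..N}" using assms by auto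
  have "(\<Sum>q\<le>g. (\<Sum>n\<le>q. \<beta> (q - n) n) * x ^ q) = (\<Sum>q\<le>g. \<Sum>n\<le>q. \<beta> (q - n) n * x ^ ((q - n) + n))"
    by (simp add: sum_distrib_right)
  also have "\<dots> = (\<Sum>(n, h)\<in>?T. \<beta> h n * x ^ (h + n))"
    by (rule sum.triangle_reindex_eq[symmetric])
  finally have 1: "(\<Sum>q\<le>g. (\<Sum>n\<le>q. \<beta> (q - n) n) * x ^ q) = \<dots>" .
  have "(\<Sum>h\<le>N. \<Sum>n\<le>N. \<beta> h n * x ^ (h + n)) = (\<Sum>(n, h)\<in>{..N} \<times> {..N}. \<beta> h n * x ^ (h + n))"
    by (subst sum.swap) (simp add: sum.cartesian_product)
  also have "\<dots> = (\<Sum>(n, h)\<in>?R. \<beta> h n * x ^ (h + n)) + (\<Sum>(n, h)\<in>?T. \<beta> h n * x ^ (h + n))"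
    by (rule sum.subset_diff[OF T]) auto
  finally have "\<bar>(\<Sum>h\<le>N. \<Sum>n\<le>N. \<beta> h n * x ^ (h + n)) - (\<Sum>q\<le>g. (\<Sum>n\<le>q. \<beta> (q - n) n) * x ^ q)\<bar> =
      \<bar>\<Sum>(n, h)\<in>?R. \<beta> h n * x ^ (h + n)\<bar>"
    by (simp add: 1)
  also have "\<dots> \<le> (\<Sum>(n, h)\<in>?R. \<bar>\<beta> h n\<bar> * x ^ (g + 1))"
    using x by (intro order_trans[OF sum_abs] sum_mono)
      (auto simp: abs_mult intro!: mult_left_mono power_decreasing simp del: power_Suc)
  also have "\<dots> = (\<Sum>(n, h)\<in>?R. \<bar>\<beta> h n\<bar>) * x ^ (g + 1)"
    by (simp add: sum_distrib_right case_prod_unfold)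
  finally show "\<bar>(\<Sum>h\<le>N. \<Sum>n\<le>N. \<beta> h n * x ^ (h + n)) - (\<Sum>q\<le>g. (\<Sum>n\<le>q. \<beta> (q - n) n) * x ^ q)\<bar> \<le>
      (\<Sum>(n, h)\<in>?R. \<bar>\<beta> h n\<bar>) * x ^ (g + 1)" .
qed

text \<open>The error \<open>k\<^sup>2\<^sup>-\<^sup>2\<^sup>N\<close> of \<open>\<Phi>\<close> is two orders worse than that of the second difference,
  hence the choice \<open>N = g + 2\<close>.\<close>

lemma second_difference_expansion:
  fixes D :: "nat \<Rightarrow> nat \<Rightarrow> real \<Rightarrow> real" and \<Phi> :: "nat \<Rightarrow> real \<Rightarrow> real"
  assumes "\<eta> > 0"
    and der: "\<And>h n w. w \<in> {1 - \<eta>..1 + \<eta>} \<Longrightarrow> (D h n has_field_derivative D h (Suc n) w) (at w)"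
    and \<Phi>: "\<forall>\<^sub>F k in sequentially. \<forall>w\<in>{1 - 1 / real k, 1, 1 + 1 / real k}.
      \<bar>\<Phi> k w - (\<Sum>h\<le>g + 2. D h 0 w * real k powi (2 - 2 * int h))\<bar> \<le> K * real k powi (2 - 2 * int (g + 2))"
  shows "\<exists>C. \<forall>\<^sub>F k in sequentially.
    \<bar>\<Phi> k (1 + 1 / real k) - 2 * \<Phi> k 1 + \<Phi> k (1 - 1 / real k) -
      (\<Sum>q\<le>g. (\<Sum>n\<le>q. 2 / fact (2 * n + 2) * D (q - n) (2 * n + 2) 1) * (1 / real k ^ 2) ^ q)\<bar>
    \<le> C * (1 / real k ^ 2) ^ (g + 1)"
proof -
  let ?N = "g + 2"
  define \<beta> where "\<beta> h n = 2 / fact (2 * n + 2) * D h (2 * n + 2) 1" for h n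
  define R where "R h C \<longleftrightarrow> (\<forall>\<epsilon>. 0 < \<epsilon> \<longrightarrow> \<epsilon> \<le> \<eta> \<longrightarrow> \<bar>D h 0 (1 + \<epsilon>) - 2 * D h 0 1 + D h 0 (1 - \<epsilon>) -
      (\<Sum>n<Suc ?N. \<beta> h n * \<epsilon> ^ (2 * n + 2))\<bar> \<le> C * \<epsilon> ^ (2 * Suc ?N + 2))" for h C
  have "\<exists>C. C \<ge> 0 \<and> R h C" for h
  proof (rule second_difference_taylor[of \<eta> 1 "D h" "Suc ?N", OF assms(1) der])
    fix C assume "C \<ge> 0" "\<And>\<epsilon>. 0 < \<epsilon> \<Longrightarrow> \<epsilon> \<le> \<eta> \<Longrightarrow>
      \<bar>D h 0 (1 + \<epsilon>) - 2 * D h 0 1 + D h 0 (1 - \<epsilon>) -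
      (\<Sum>n<Suc ?N. 2 / fact (2 * n + 2) * D h (2 * n + 2) 1 * \<epsilon> ^ (2 * n + 2))\<bar> \<le> C * \<epsilon> ^ (2 * Suc ?N + 2)"
    then show ?thesis unfolding \<beta>_def R_def by (intro exI[of _ C] conjI allI impI)
  qed
  then obtain C1 where C1: "\<And>h. C1 h \<ge> 0" and R: "\<And>h. R h (C1 h)"
    by metis
  obtain C2 where C2: "\<And>x. 0 \<le> x \<Longrightarrow> x \<le> 1 \<Longrightarrow>
    \<bar>(\<Sum>h\<le>?N. \<Sum>n\<le>?N. \<beta> h n * x ^ (h + n)) - (\<Sum>q\<le>g. (\<Sum>n\<le>q. \<beta> (q - n) n) * x ^ q)\<bar> \<le> C2 * x ^ (g + 1)"
    using triangle_truncation_bound[of g ?N \<beta>] by auto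
  have "\<forall>\<^sub>F k in sequentially. \<bar>\<Phi> k (1 + 1 / real k) - 2 * \<Phi> k 1 + \<Phi> k (1 - 1 / real k) -
      (\<Sum>q\<le>g. (\<Sum>n\<le>q. \<beta> (q - n) n) * (1 / real k ^ 2) ^ q)\<bar>
    \<le> (4 * K + (\<Sum>h\<le>?N. C1 h) + C2) * (1 / real k ^ 2) ^ (g + 1)"
    using \<Phi> eventually_gt_at_top[of 0] eventually_ge_at_top[of "nat \<lceil>1 / \<eta>\<rceil>"]
  proof eventually_elim
    case (elim k)
    define \<epsilon> where "\<epsilon> = 1 / real k"
    define x where "x = \<epsilon>\<^sup>2"
    have k: "real k > 0" using elim by simp
    have \<epsilon>: "0 < \<epsilon>" "\<epsilon> \<le> 1" using k elim(2) by (auto simp: \<epsilon>_def)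
    have "1 / \<eta> \<le> real k" using elim(3) by linarith
    then have "\<epsilon> \<le> \<eta>" using k assms(1) by (simp add: \<epsilon>_def field_simps)
    have x2: "\<epsilon> ^ (2 * m) = x ^ m" for m by (simp add: x_def power_mult)
    have x: "0 < x" "x \<le> 1" using \<epsilon> by (auto simp: x_def power_le_one)
    have xk: "1 / real k ^ 2 = x" by (simp add: x_def \<epsilon>_def power_divide)
    \<comment> \<open>Everything is expressed in \<open>x = 1/k^2\<close>. The denominator
      \<open>x\<close> cancels against the \<open>\<epsilon>^2\<close> contained in every Taylor
      term.\<close>
    have kp: "real k powi (2 - 2 * int h) = x ^ h / x" for h
    proof -
      have "real k powi (2 - 2 * int h) = real k ^ 2 / real k ^ (2 * h)"
      proof -
        have "real k powi (int 2 - int (2 * h)) = real k powi int 2 / real k powi int (2 * h)"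
          by (rule power_int_diff) (use k in simp)
        then show ?thesis by (simp only: power_int_of_nat) simp
      qed
      also have "\<dots> = (1 / real k ^ 2) ^ h / (1 / real k ^ 2)"
        by (simp add: power_one_over power_mult)
      finally show ?thesis unfolding xk .
    qed
    \<comment> \<open>The second difference minus \<open>A\<close> splits into the errors
      \<open>E\<close> of the expansion at the three points, which contribute \<open>4 * K\<close>,
      the Taylor remainders \<open>T\<close> of the coefficient functions, and the discarded part
      \<open>Q - A\<close>. Each is of order \<open>x^(g+1)\<close>.\<close>
    define P where "P w = (\<Sum>h\<le>?N. D h 0 w * (x ^ h / x))" for w
    define E where "E w = \<Phi> k w - P w" for w
    define Q where "Q = (\<Sum>h\<le>?N. \<Sum>n\<le>?N. \<beta> h n * x ^ (h + n))"
    define A where "A = (\<Sum>q\<le>g. (\<Sum>n\<le>q. \<beta> (q - n) n) * x ^ q)"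
    have E: "\<bar>E w\<bar> \<le> K * x ^ (g + 1)" if "w \<in> {1 - \<epsilon>, 1, 1 + \<epsilon>}" for w
    proof -
      have N: "x ^ ?N / x = x ^ (g + 1)" using x by simp
      have "\<bar>\<Phi> k w - (\<Sum>h\<le>?N. D h 0 w * real k powi (2 - 2 * int h))\<bar> \<le> K * real k powi (2 - 2 * int ?N)"
        using elim(1) that unfolding \<epsilon>_def by (rule bspec)
      then show ?thesis unfolding E_def P_def kp N .
    qed
    define T where "T h = D h 0 (1 + \<epsilon>) - 2 * D h 0 1 + D h 0 (1 - \<epsilon>) -
      (\<Sum>n<Suc ?N. \<beta> h n * \<epsilon> ^ (2 * n + 2))" for h
    have T: "\<bar>T h * (x ^ h / x)\<bar> \<le> C1 h * x ^ (g + 1)" for h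
    proof -
      have "\<bar>T h * (x ^ h / x)\<bar> = \<bar>T h\<bar> * (x ^ h / x)" using x by (simp add: abs_mult)
      also have "\<dots> \<le> (C1 h * \<epsilon> ^ (2 * Suc ?N + 2)) * (x ^ h / x)"
        using R[of h] \<epsilon>(1) \<open>\<epsilon> \<le> \<eta>\<close> x unfolding T_def R_def by (intro mult_right_mono) auto
      also have "\<epsilon> ^ (2 * Suc ?N + 2) = x ^ (g + 4)"
      proof -
        have "2 * Suc ?N + 2 = 2 * (g + 4)" by simp
        then show ?thesis by (simp only: x2)
      qed
      also have "C1 h * x ^ (g + 4) * (x ^ h / x) = C1 h * x ^ (g + 3 + h)"
      proof -
        have "u * (x * v) * (y / x) = u * (v * y)" for u v y using x by simp
        moreover have "g + 4 = Suc (g + 3)" by simp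
        ultimately show ?thesis by (simp only: power_Suc power_add[of x "g + 3" h])
      qed
      also have "\<dots> \<le> C1 h * x ^ (g + 1)"
        using x C1[of h] by (intro mult_left_mono power_decreasing) auto
      finally show ?thesis .
    qed
    have "(\<Sum>n<Suc ?N. \<beta> h n * \<epsilon> ^ (2 * n + 2)) * (x ^ h / x) = (\<Sum>n\<le>?N. \<beta> h n * x ^ (h + n))" for h
    proof -
      have "\<epsilon> ^ (2 * n + 2) * (x ^ h / x) = x ^ (h + n)" for n
      proof -
        have "\<epsilon> ^ (2 * n + 2) = x ^ n * x" using x2[of "n + 1"] by simp
        moreover have "(v * x) * (y / x) = y * v" for v y using x by simp
        ultimately show ?thesis by (simp only: power_add[of x h n])
      qed
      then show ?thesis by (simp only: sum_distrib_right mult.assoc lessThan_Suc_atMost)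
    qed
    then have "T h * (x ^ h / x) = D h 0 (1 + \<epsilon>) * (x ^ h / x) - 2 * (D h 0 1 * (x ^ h / x)) +
        D h 0 (1 - \<epsilon>) * (x ^ h / x) - (\<Sum>n\<le>?N. \<beta> h n * x ^ (h + n))" for h
      unfolding T_def by (simp only: left_diff_distrib distrib_right mult.assoc)
    then have "(\<Sum>h\<le>?N. T h * (x ^ h / x)) = P (1 + \<epsilon>) - 2 * P 1 + P (1 - \<epsilon>) - Q"
      unfolding P_def Q_def by (simp only: sum_subtractf sum.distrib sum_distrib_left)
    then have "\<Phi> k (1 + \<epsilon>) - 2 * \<Phi> k 1 + \<Phi> k (1 - \<epsilon>) - A =
        E (1 + \<epsilon>) - 2 * E 1 + E (1 - \<epsilon>) + (\<Sum>h\<le>?N. T h * (x ^ h / x)) + (Q - A)"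
      unfolding E_def by simp
    moreover have "\<bar>\<Sum>h\<le>?N. T h * (x ^ h / x)\<bar> \<le> (\<Sum>h\<le>?N. C1 h) * x ^ (g + 1)"
      unfolding sum_distrib_right by (intro order_trans[OF sum_abs] sum_mono T)
    moreover have "\<bar>E (1 + \<epsilon>)\<bar> \<le> K * x ^ (g + 1)" "\<bar>E (1 - \<epsilon>)\<bar> \<le> K * x ^ (g + 1)"
      "\<bar>E 1\<bar> \<le> K * x ^ (g + 1)" by (rule E; simp)+
    moreover have "(4 * K + (\<Sum>h\<le>?N. C1 h) + C2) * x ^ (g + 1) =
      4 * (K * x ^ (g + 1)) + (\<Sum>h\<le>?N. C1 h) * x ^ (g + 1) + C2 * x ^ (g + 1)"
      by (simp only: distrib_right mult.assoc)
    moreover have "\<bar>Q - A\<bar> \<le> C2 * x ^ (g + 1)"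
      unfolding Q_def A_def by (rule C2[OF less_imp_le[OF x(1)] x(2)])
    ultimately have "\<bar>\<Phi> k (1 + \<epsilon>) - 2 * \<Phi> k 1 + \<Phi> k (1 - \<epsilon>) - A\<bar> \<le>
        (4 * K + (\<Sum>h\<le>?N. C1 h) + C2) * x ^ (g + 1)"
      by linarith
    then show ?case unfolding xk \<epsilon>_def[symmetric] A_def .
  qed
  then show ?thesis unfolding \<beta>_def by (intro exI)
qed

section \<open>Uniqueness of coefficients; exponential and logarithm of expansions\<close>

lemma smallo_power_sum_imp_coeffs_0:
  fixes d x :: "nat \<Rightarrow> real"
  assumes x: "x \<longlonglongrightarrow> 0" and pos: "\<forall>\<^sub>F k in sequentially. x k > 0"
    and "(\<lambda>k. \<Sum>q\<le>g. d q * x k ^ q) \<in> o[sequentially](\<lambda>k. x k ^ g)"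
    and "q \<le> g"
  shows "d q = 0"
  using assms(3,4)
proof (induction g arbitrary: q)
  case 0
  then have "(\<lambda>k. d 0 / 1) \<longlonglongrightarrow> 0"
    using smalloD_tendsto[OF 0(1)] by simp
  with 0 show ?case by (simp add: LIMSEQ_const_iff)
next
  case (Suc g)
  have "(\<lambda>k. x k * x k ^ g) \<in> o[sequentially](\<lambda>k. 1 * x k ^ g)"
    using x by (intro landau_o.small_big_mult smalloI_tendsto) auto
  then have o: "(\<lambda>k. x k ^ Suc g) \<in> o[sequentially](\<lambda>k. x k ^ g)" by simp
  have o': "(\<lambda>k. d (Suc g) * x k ^ Suc g) \<in> o[sequentially](\<lambda>k. x k ^ g)"
    using o by (cases "d (Suc g) = 0") simp_all
  from sum_in_smallo(2)[OF landau_o.small_trans[OF Suc.prems(1) o] o']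
  have "(\<lambda>k. \<Sum>q\<le>g. d q * x k ^ q) \<in> o[sequentially](\<lambda>k. x k ^ g)" by simp
  \<comment> \<open>Since \<open>x k\<close> tends to \<open>0\<close>, the top term is negligible
    at order \<open>g\<close>, and the induction hypothesis kills all lower coefficients. What
    remains is the top term alone, to be divided by \<open>x k ^ Suc g\<close>.\<close>
  note d0 = Suc.IH[OF this]
  then have "(\<lambda>k. d (Suc g) * x k ^ Suc g) \<in> o[sequentially](\<lambda>k. x k ^ Suc g)"
    using Suc.prems(1) by simp
  from smalloD_tendsto[OF this] have "(\<lambda>k. d (Suc g) * x k ^ Suc g / x k ^ Suc g) \<longlonglongrightarrow> 0" .
  moreover have "\<forall>\<^sub>F k in sequentially. d (Suc g) * x k ^ Suc g / x k ^ Suc g = d (Suc g)"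
    using pos by eventually_elim simp
  ultimately have "(\<lambda>k. d (Suc g)) \<longlonglongrightarrow> 0"
    by (rule Lim_transform_eventually)
  then have "d (Suc g) = 0" by (simp add: LIMSEQ_const_iff)
  with d0 Suc.prems(2) show ?case by (cases "q = Suc g") auto
qed

text \<open>The recursion is \<open>F' = A' F\<close> read off coefficientwise, for
  \<open>F = exp A\<close>. The constant term is split off because formal composition needs an inner
  series without one.\<close>

lemma exp_series_coeffs:
  fixes a :: "nat \<Rightarrow> real"
  obtains B where "B 0 = exp (a 0)"
    "\<And>n. real (Suc n) * B (Suc n) = (\<Sum>i\<le>n. real (Suc i) * a (Suc i) * B (n - i))"
proof -
  define A where "A = Abs_fps a"
  define F where "F = fps_const (exp (a 0)) * fps_compose (fps_exp 1) (A - fps_const (a 0))"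
  have A0: "fps_nth (A - fps_const (a 0)) 0 = 0" by (simp add: A_def)
  have dF: "fps_deriv F = fps_deriv A * F"
    by (simp add: F_def fps_compose_deriv[OF A0] mult_ac)
  show thesis
  proof (rule that)
    show "fps_nth F 0 = exp (a 0)" by (simp add: F_def)
    show "real (Suc n) * fps_nth F (Suc n) =
        (\<Sum>i\<le>n. real (Suc i) * a (Suc i) * fps_nth F (n - i))" for n
      using arg_cong[OF dF, of "\<lambda>f. fps_nth f n"]
      by (simp add: fps_mult_nth A_def atLeast0AtMost)
  qed
qed

text \<open>Multiplying the truncated series by \<open>exp (- A)\<close> gives a function with derivative \<open>O(x^g)\<close>.\<close>

lemma exp_poly_expansion:
  fixes a B :: "nat \<Rightarrow> real"
  assumes B0: "B 0 = exp (a 0)"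
    and B: "\<And>n. real (Suc n) * B (Suc n) = (\<Sum>i\<le>n. real (Suc i) * a (Suc i) * B (n - i))"
  shows "\<exists>C. \<forall>x. 0 \<le> x \<longrightarrow> x \<le> 1 \<longrightarrow>
    \<bar>exp (\<Sum>q\<le>g. a q * x ^ q) - (\<Sum>q\<le>g. B q * x ^ q)\<bar> \<le> C * x ^ (g + 1)"
proof -
  define A where "A = (\<Sum>q\<le>g. Polynomial.monom (a q) q)"
  define P where "P = (\<Sum>q\<le>g. Polynomial.monom (B q) q)"
  have A: "poly A x = (\<Sum>q\<le>g. a q * x ^ q)" and P: "poly P x = (\<Sum>q\<le>g. B q * x ^ q)" for x
    by (simp_all add: A_def P_def poly_sum poly_monom)
  have cA: "Polynomial.coeff A n = (if n \<le> g then a n else 0)"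
    and cP: "Polynomial.coeff P n = (if n \<le> g then B n else 0)" for n
    by (simp_all add: A_def P_def coeff_sum Polynomial.coeff_monom)
  define R where "R = pderiv P - pderiv A * P"
  \<comment> \<open>Below \<open>x^g\<close> the truncation is not yet felt, and the recursion for
    \<open>B\<close> says exactly that \<open>P' = A' P\<close> there. Hence \<open>x^g\<close>
    divides \<open>R\<close>, and with it the derivative \<open>R exp (- A)\<close> of
    \<open>f\<close>.\<close>
  have "Polynomial.coeff R n = 0" if "n < g" for n
  proof -
    have "Polynomial.coeff (pderiv A * P) n = (\<Sum>i\<le>n. real (Suc i) * a (Suc i) * B (n - i))"
      unfolding Polynomial.coeff_mult using that
      by (intro sum.cong) (auto simp: coeff_pderiv cA cP)
    then show ?thesis using that B[of n] by (simp add: R_def coeff_pderiv cP)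
  qed
  then have "Polynomial.monom 1 g dvd R" by (simp add: monom_1_dvd_iff')
  then obtain Q where Q: "R = Polynomial.monom 1 g * Q" by (rule dvdE)
  define f where "f x = poly P x * exp (- poly A x)" for x
  have der: "(f has_field_derivative x ^ g * (poly Q x * exp (- poly A x))) (at x)" for x
  proof -
    have "(f has_field_derivative poly R x * exp (- poly A x)) (at x)"
      unfolding f_def R_def by (auto intro!: derivative_eq_intros simp: algebra_simps)
    then show ?thesis by (simp add: Q poly_monom mult_ac)
  qed
  have bdd: "\<exists>K. \<forall>x\<in>{0..1}. \<bar>h x\<bar> \<le> K" if "continuous_on {0..1} h" for h :: "real \<Rightarrow> real"
    using compact_imp_bounded[OF compact_continuous_image[OF that]]
    by (auto simp: bounded_iff)
  obtain K1 where K1: "\<forall>x\<in>{0..1}. \<bar>poly Q x * exp (- poly A x)\<bar> \<le> K1"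
    using bdd[of "\<lambda>x. poly Q x * exp (- poly A x)"] by (force intro!: continuous_intros)
  obtain K2 where K2: "\<forall>x\<in>{0..1}. \<bar>exp (poly A x)\<bar> \<le> K2"
    using bdd[of "\<lambda>x. exp (poly A x)"] by (force intro!: continuous_intros)
  have A0: "poly A 0 = a 0" and P0: "poly P 0 = B 0"
    by (simp_all add: poly_0_coeff_0 cA cP)
  have f0: "f 0 = 1"
    by (simp add: f_def A0 P0 B0 flip: exp_add)
  show ?thesis
  proof (intro exI[of _ "K2 * K1"] allI impI)
    fix x :: real assume x: "0 \<le> x" "x \<le> 1"
    have "\<bar>f x - 1\<bar> \<le> K1 * x ^ (g + 1)"
    proof (cases "x = 0")
      case False
      with x have "0 < x" by simp
      from MVT2[OF this, of f "\<lambda>x. x ^ g * (poly Q x * exp (- poly A x))"] der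
      obtain t where t: "0 < t" "t < x" "f x - f 0 = (x - 0) * (t ^ g * (poly Q t * exp (- poly A t)))"
        by auto
      have "\<bar>f x - 1\<bar> = x * (t ^ g * \<bar>poly Q t * exp (- poly A t)\<bar>)"
        using t x by (simp add: f0 abs_mult)
      also have "\<dots> \<le> x * (x ^ g * K1)"
        using t x K1 by (intro mult_left_mono mult_mono power_mono) auto
      finally show ?thesis by (simp add: mult_ac)
    qed (simp add: f0)
    then have "\<bar>exp (poly A x)\<bar> * \<bar>f x - 1\<bar> \<le> K2 * (K1 * x ^ (g + 1))"
      using K2 x by (intro mult_mono order_trans[OF abs_ge_zero K2[rule_format, of x]]) auto
    also have "\<bar>exp (poly A x)\<bar> * \<bar>f x - 1\<bar> = \<bar>exp (poly A x) - poly P x\<bar>"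
    proof -
      have "exp (poly A x) * exp (- poly A x) = 1" by (simp flip: exp_add)
      then have "exp (poly A x) * (f x - 1) = poly P x - exp (poly A x)"
        by (simp add: f_def algebra_simps)
      then have "\<bar>exp (poly A x) * (f x - 1)\<bar> = \<bar>poly P x - exp (poly A x)\<bar>" by (rule arg_cong)
      then show ?thesis by (simp only: abs_mult abs_minus_commute)
    qed
    finally show "\<bar>exp (\<Sum>q\<le>g. a q * x ^ q) - (\<Sum>q\<le>g. B q * x ^ q)\<bar> \<le> K2 * K1 * x ^ (g + 1)"
      by (simp only: A P mult.assoc)
  qed
qed

text \<open>The chain rule with the derivative \<open>1/(1+X)\<close> of \<open>fps_ln 1\<close>;
  the normalising factor \<open>c\<close> cancels. In this form the logarithm obeys the same
  recursion as the exponent in \<open>exp_series_coeffs\<close>.\<close>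

lemma fps_deriv_fps_log:
  assumes "fps_nth F 0 > 0"
  shows "fps_deriv (fps_log F) * F = fps_deriv F"
proof -
  define c where "c = 1 / fps_nth F 0"
  define G where "G = fps_const c * F - 1"
  have c: "c > 0" using assms by (simp add: c_def)
  have G0: "fps_nth G 0 = 0" using assms by (simp add: G_def c_def)
  have "fps_compose (inverse (1 + fps_X)) G = inverse (1 + G)"
    by (subst fps_inverse_compose[OF G0]) (simp_all add: fps_compose_add_distrib G0)
  then have "fps_deriv (fps_log F) = inverse (1 + G) * (fps_const c * fps_deriv F)"
    unfolding fps_log_def c_def[symmetric] G_def[symmetric]
    by (simp add: fps_compose_deriv[OF G0] fps_ln_deriv) (simp add: G_def)
  then have "fps_deriv (fps_log F) * F = inverse (1 + G) * (1 + G) * fps_deriv F"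
    by (simp add: G_def mult_ac)
  also have "inverse (1 + G) * (1 + G) = 1"
    by (rule inverse_mult_eq_1) (simp add: G0)
  finally show ?thesis by simp
qed

text \<open>The logarithm and \<open>a\<close> solve the same triangular recursion, and the positive
  \<open>z 0\<close> in front of the newest coefficient makes the solution unique. The recursion
  below \<open>g\<close> settles the indices up to \<open>g\<close>.\<close>

lemma fps_log_nth_eqI:
  fixes a z :: "nat \<Rightarrow> real"
  assumes "z 0 > 0" "z 0 = exp (a 0)"
    and z: "\<And>n. n < g \<Longrightarrow> real (Suc n) * z (Suc n) = (\<Sum>i\<le>n. real (Suc i) * a (Suc i) * z (n - i))"
    and "n \<le> g"
  shows "fps_nth (fps_log (Abs_fps z)) n = a n"
  using \<open>n \<le> g\<close>
proof (induction n rule: less_induct)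
  case (less n)
  let ?L = "fps_log (Abs_fps z)"
  show ?case
  proof (cases n)
    case 0
    then show ?thesis using assms(2) by (simp add: fps_log_def)
  next
    case (Suc m)
    have "real (Suc m) * z (Suc m) = (\<Sum>i\<le>m. real (Suc i) * fps_nth ?L (Suc i) * z (m - i))"
      using arg_cong[OF fps_deriv_fps_log[of "Abs_fps z"], of "\<lambda>f. fps_nth f m"] assms(1)
      by (simp add: fps_mult_nth atLeast0AtMost)
    moreover have "\<dots> = (\<Sum>i<m. real (Suc i) * a (Suc i) * z (m - i)) + real (Suc m) * fps_nth ?L (Suc m) * z 0"
      using less Suc by (simp add: lessThan_Suc_atMost[symmetric] del: of_nat_Suc)
    moreover have "real (Suc m) * z (Suc m) =
        (\<Sum>i<m. real (Suc i) * a (Suc i) * z (m - i)) + real (Suc m) * a (Suc m) * z 0"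
      using z[of m] less.prems Suc by (simp add: lessThan_Suc_atMost[symmetric] del: of_nat_Suc)
    ultimately have "real (Suc m) * fps_nth ?L (Suc m) * z 0 = real (Suc m) * a (Suc m) * z 0"
      by linarith
    then show ?thesis using assms(1) Suc by simp
  qed
qed

text \<open>The sets \<open>T M\<close> where the bound \<open>M\<close> fails are relatively open.
  Were all of them dense in \<open>S\<close>, Baire's theorem would give a point lying in every
  \<open>T M\<close>, against pointwise boundedness. So some \<open>T M\<close> leaves a relatively
  open piece of \<open>S\<close> free, and as \<open>S\<close> lies in the closure of its interior,
  this piece contains a nonempty set open in the whole space.\<close>

lemma pointwise_bounded_imp_uniformly_bounded_on_open:
  fixes f :: "nat \<Rightarrow> 'a :: {real_normed_vector, heine_borel} \<Rightarrow> real"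
  assumes "closed S" "S \<noteq> {}" "S \<subseteq> closure (interior S)"
    and cont: "\<And>k. continuous_on S (f k)"
    and bdd: "\<And>x. x \<in> S \<Longrightarrow> \<exists>M. \<forall>k. \<bar>f k x\<bar> \<le> M"
  shows "\<exists>U M. open U \<and> U \<noteq> {} \<and> U \<subseteq> S \<and> (\<forall>x\<in>U. \<forall>k. \<bar>f k x\<bar> \<le> M)"
proof -
  define T where "T M = {x\<in>S. \<exists>k. real M < \<bar>f k x\<bar>}" for M :: nat
  have "\<exists>M. \<not> S \<subseteq> closure (T M)"
  proof (rule ccontr)
    assume "\<nexists>M. \<not> S \<subseteq> closure (T M)"
    moreover have "openin (top_of_set S) (T M)" for M
    proof -
      have "T M = (\<Union>k. S \<inter> (\<lambda>x. \<bar>f k x\<bar>) -` {real M<..})" by (auto simp: T_def)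
      moreover have "openin (top_of_set S) (S \<inter> (\<lambda>x. \<bar>f k x\<bar>) -` {real M<..})" for k
        by (intro continuous_openin_preimage_gen continuous_on_rabs cont open_greaterThan)
      ultimately show ?thesis by (metis (no_types, lifting) imageE openin_Union)
    qed
    ultimately have "S \<subseteq> closure (\<Inter>(range T))"
      using \<open>closed S\<close> by (intro Baire) auto
    then have "\<Inter>(range T) \<noteq> {}" using \<open>S \<noteq> {}\<close> by auto
    then obtain x where x: "\<And>M. x \<in> T M" by auto
    then have "x \<in> S" by (auto simp: T_def)
    then obtain M where M: "\<And>k. \<bar>f k x\<bar> \<le> M" using bdd by blast
    obtain N :: nat where "M \<le> real N" using real_arch_simple by blast
    moreover obtain k where "real N < \<bar>f k x\<bar>" using x[of N] by (auto simp: T_def)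
    ultimately show False using M[of k] by linarith
  qed
  then obtain M x where x: "x \<in> S" "x \<notin> closure (T M)" by blast
  define U where "U = - closure (T M) \<inter> interior S"
  show ?thesis
  proof (intro exI[of _ U] exI[of _ "real M"] conjI ballI allI)
    show "open U" by (auto simp: U_def)
    have "x \<in> closure (interior S)" using x assms(3) by auto
    then show "U \<noteq> {}"
      unfolding U_def using x(2) open_Int_closure_eq_empty[of "- closure (T M)" "interior S"] by auto
    show "U \<subseteq> S" using interior_subset by (auto simp: U_def)
    fix y k assume "y \<in> U"
    then have "y \<in> S" "y \<notin> T M" using interior_subset closure_subset by (auto simp: U_def)
    then show "\<bar>f k y\<bar> \<le> real M" by (auto simp: T_def not_less)
  qed
qed

lemma bound_imp_smallo_power:
  fixes f x :: "nat \<Rightarrow> real"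
  assumes x: "x \<longlonglongrightarrow> 0" and bd: "\<forall>\<^sub>F k in sequentially. \<bar>f k\<bar> \<le> C * \<bar>x k\<bar> ^ (g + 1)"
  shows "f \<in> o[sequentially](\<lambda>k. x k ^ g)"
proof -
  have "(\<lambda>k. x k * x k ^ g) \<in> o[sequentially](\<lambda>k. 1 * x k ^ g)"
    using x by (intro landau_o.small_big_mult smalloI_tendsto) auto
  then have o: "(\<lambda>k. x k ^ (g + 1)) \<in> o[sequentially](\<lambda>k. x k ^ g)" by simp
  have "f \<in> O[sequentially](\<lambda>k. x k ^ (g + 1))"
    by (rule bigoI[of _ C]) (use bd in \<open>simp add: power_abs abs_mult\<close>)
  from landau_o.big_small_trans[OF this o] show ?thesis .
qed

lemma abs_exp_minus_one_le:
  fixes r :: real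
  assumes "\<bar>r\<bar> \<le> 1 / 2"
  shows "\<bar>exp r - 1\<bar> \<le> 2 * \<bar>r\<bar>"
proof -
  have "exp r \<le> 1 + 2 * \<bar>r\<bar>" using exp_bound_lemma[of r] assms by simp
  moreover have "1 + r \<le> exp r" by (rule exp_ge_add_one_self)
  ultimately show ?thesis by linarith
qed

text \<open>Intended for \<open>u k = b_k^2 / k\<close>, its Gaussian counterpart \<open>v k\<close>
  and the second difference \<open>y k\<close>. Working with \<open>exp (y k)\<close> avoids the
  logarithm of an asymptotic series whose leading coefficient is not known beforehand to be
  positive.\<close>

lemma exp_expansion_coeffs:
  fixes x y u v a z :: "nat \<Rightarrow> real"
  assumes x: "x \<longlonglongrightarrow> 0" and pos: "\<forall>\<^sub>F k in sequentially. x k > 0"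
    and y: "\<forall>\<^sub>F k in sequentially. \<bar>y k - (\<Sum>q\<le>g. a q * x k ^ q)\<bar> \<le> C * x k ^ (g + 1)"
    and v: "(\<lambda>k. v k - 1) \<in> o[sequentially](\<lambda>k. x k ^ g)"
    and u: "(\<lambda>k. u k - (\<Sum>q\<le>g. z q * x k ^ q)) \<in> o[sequentially](\<lambda>k. x k ^ g)"
    and uyv: "\<forall>\<^sub>F k in sequentially. u k = exp (y k) * v k"
  shows "z 0 = exp (a 0)"
    and "n < g \<Longrightarrow> real (Suc n) * z (Suc n) = (\<Sum>i\<le>n. real (Suc i) * a (Suc i) * z (n - i))"
proof -
  obtain B where B: "B 0 = exp (a 0)"
    "\<And>n. real (Suc n) * B (Suc n) = (\<Sum>i\<le>n. real (Suc i) * a (Suc i) * B (n - i))"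
    using exp_series_coeffs[of a] by blast
  define A where "A k = (\<Sum>q\<le>g. a q * x k ^ q)" for k
  define r where "r k = y k - A k" for k
  have "A \<longlonglongrightarrow> (\<Sum>q\<le>g. a q * 0 ^ q)"
    unfolding A_def by (intro tendsto_intros x)
  from tendsto_exp[OF this] have expA: "(\<lambda>k. exp (A k)) \<in> O[sequentially](\<lambda>_. 1)"
    by (intro bigoI_tendsto[where c = "exp (\<Sum>q\<le>g. a q * 0 ^ q)"]) auto
  have y': "\<forall>\<^sub>F k in sequentially. \<bar>r k\<bar> \<le> C * \<bar>x k\<bar> ^ (g + 1)"
    using y pos by eventually_elim (simp add: r_def A_def)
  have "(\<lambda>k. C * \<bar>x k\<bar> ^ (g + 1)) \<longlonglongrightarrow> C * \<bar>0\<bar> ^ (g + 1)"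
    by (intro tendsto_intros x)
  then have "r \<longlonglongrightarrow> 0"
    using y' by (intro Lim_null_comparison[of r "\<lambda>k. C * \<bar>x k\<bar> ^ (g + 1)"]) auto
  then have r_half: "\<forall>\<^sub>F k in sequentially. \<bar>r k\<bar> < 1 / 2"
    by (auto dest!: tendstoD[where e = "1 / 2"])
  have expr: "(\<lambda>k. exp (r k) - 1) \<in> o[sequentially](\<lambda>k. x k ^ g)"
  proof (rule bound_imp_smallo_power[OF x, where C = "2 * C"])
    show "\<forall>\<^sub>F k in sequentially. \<bar>exp (r k) - 1\<bar> \<le> 2 * C * \<bar>x k\<bar> ^ (g + 1)"
      using y' r_half
    proof eventually_elim
      case (elim k)
      then show ?case using abs_exp_minus_one_le[of "r k"] by linarith
    qed
  qed
  have expA_expr: "(\<lambda>k. exp (A k) * (exp (r k) - 1)) \<in> o[sequentially](\<lambda>k. x k ^ g)"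
    using landau_o.big_small_mult[OF expA expr] by simp
  have "(\<lambda>k. exp (r k)) \<in> O[sequentially](\<lambda>_. 1)"
    using tendsto_exp[OF \<open>r \<longlonglongrightarrow> 0\<close>] by (intro bigoI_tendsto[where c = 1]) auto
  from landau_o.big_mult[OF expA this] have "(\<lambda>k. exp (A k) * exp (r k)) \<in> O[sequentially](\<lambda>_. 1)"
    by simp
  from landau_o.big_small_mult[OF this v]
  have vpart: "(\<lambda>k. exp (A k) * exp (r k) * (v k - 1)) \<in> o[sequentially](\<lambda>k. x k ^ g)" by simp
  obtain C' where C': "\<forall>x. 0 \<le> x \<longrightarrow> x \<le> 1 \<longrightarrow>
      \<bar>exp (\<Sum>q\<le>g. a q * x ^ q) - (\<Sum>q\<le>g. B q * x ^ q)\<bar> \<le> C' * x ^ (g + 1)"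
    using exp_poly_expansion[of B a g, OF B] by blast
  have "\<forall>\<^sub>F k in sequentially. x k < 1" using order_tendstoD(2)[OF x, of 1] by simp
  then have Bpart: "(\<lambda>k. exp (A k) - (\<Sum>q\<le>g. B q * x k ^ q)) \<in> o[sequentially](\<lambda>k. x k ^ g)"
    using pos
    by (intro bound_imp_smallo_power[OF x, where C = C']; eventually_elim) (use C' in \<open>simp add: A_def\<close>)
  \<comment> \<open>The three added terms telescope to \<open>u k\<close> minus the sum of
    \<open>B q * x k ^ q\<close>, so the whole expression compares the coefficients \<open>z\<close>
    and \<open>B\<close>.\<close>
  have "(\<lambda>k. (exp (A k) * exp (r k) * (v k - 1) + exp (A k) * (exp (r k) - 1) +
      (exp (A k) - (\<Sum>q\<le>g. B q * x k ^ q))) - (u k - (\<Sum>q\<le>g. z q * x k ^ q)))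
      \<in> o[sequentially](\<lambda>k. x k ^ g)"
    by (intro sum_in_smallo vpart expA_expr Bpart u)
  also have "?this \<longleftrightarrow> (\<lambda>k. \<Sum>q\<le>g. (z q - B q) * x k ^ q) \<in> o[sequentially](\<lambda>k. x k ^ g)"
  proof (rule landau_o.small.in_cong)
    show "\<forall>\<^sub>F k in sequentially. (exp (A k) * exp (r k) * (v k - 1) + exp (A k) * (exp (r k) - 1) +
      (exp (A k) - (\<Sum>q\<le>g. B q * x k ^ q))) - (u k - (\<Sum>q\<le>g. z q * x k ^ q)) =
      (\<Sum>q\<le>g. (z q - B q) * x k ^ q)"
      using uyv
    proof eventually_elim
      case (elim k)
      have "exp (y k) = exp (A k) * exp (r k)" by (simp add: r_def flip: exp_add)
      then show ?case
        by (simp add: elim left_diff_distrib sum_subtractf algebra_simps)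
    qed
  qed
  finally have zB: "z q = B q" if "q \<le> g" for q
    using smallo_power_sum_imp_coeffs_0[OF x pos, of "\<lambda>q. z q - B q" g q] that by simp
  show "z 0 = exp (a 0)" using zB[of 0] B(1) by simp
  show "real (Suc n) * z (Suc n) = (\<Sum>i\<le>n. real (Suc i) * a (Suc i) * z (n - i))" if "n < g"
    using B(2)[of n] that by (simp add: zB)
qed

section \<open>Uniformity in the parameters and the main result\<close>

text \<open>The domains of analyticity may shrink with the index, so a polydisc is shared by
  finitely many functions; the neighbourhood in the claim depends on \<open>g\<close>
  accordingly.\<close>

lemma common_double_series_radius:
  assumes "\<And>h. analytic_near_0 (f h)"
  shows "\<exists>r>0. \<forall>h\<le>N::nat. \<exists>c. has_double_series r c (f h)"
proof (induction N)
  case 0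
  then show ?case using analytic_near_0_imp_has_double_series[OF assms[of 0]] by auto
next
  case (Suc N)
  then obtain r where r: "r > 0" "\<forall>h\<le>N. \<exists>c. has_double_series r c (f h)" by blast
  obtain r' c where r': "r' > 0" "has_double_series r' c (f (Suc N))"
    using analytic_near_0_imp_has_double_series[OF assms[of "Suc N"]] by blast
  show ?case
  proof (intro exI[of _ "min r r'"] conjI allI impI)
    show "min r r' > 0" using r r' by simp
    fix h assume "h \<le> Suc N"
    then show "\<exists>c. has_double_series (min r r') c (f h)"
      using r(2) r'(2) has_double_series_mono[of _ _ _ "min r r'"]
      by (cases "h = Suc N") (force simp: le_Suc_eq)+
  qed
qed

lemma has_asymp_expansion_divide_k:
  assumes "has_asymp_expansion f (\<lambda>g k. real k * real k powi (- 2 * int g)) c"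
  shows "(\<lambda>k. f k / real k - (\<Sum>q\<le>g. c q * (1 / real k ^ 2) ^ q)) \<in> o[sequentially](\<lambda>k. (1 / real k ^ 2) ^ g)"
proof -
  have pow: "real k * real k powi (- 2 * int q) * (1 / real k) = (1 / real k ^ 2) ^ q" if "k > 0" for k q
  proof -
    have "real k powi (- 2 * int q) = inverse (real k powi int (2 * q))"
      using power_int_minus[of "real k" "int (2 * q)"] by simp
    also have "\<dots> = inverse (real k ^ (2 * q))" by (simp only: power_int_of_nat)
    also have "\<dots> = (1 / real k ^ 2) ^ q" by (simp add: power_mult power_one_over inverse_eq_divide)
    finally show ?thesis using that by simp
  qed
  have "(\<lambda>k. f k - (\<Sum>q\<le>g. c q * (real k * real k powi (- 2 * int q))))
      \<in> o[sequentially](\<lambda>k. real k * real k powi (- 2 * int g))"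
    using assms by (simp add: has_asymp_expansion_def)
  from landau_o.small_big_mult[OF this landau_o.big_refl[of "\<lambda>k. 1 / real k"]]
  have "(\<lambda>k. (f k - (\<Sum>q\<le>g. c q * (real k * real k powi (- 2 * int q)))) * (1 / real k))
      \<in> o[sequentially](\<lambda>k. real k * real k powi (- 2 * int g) * (1 / real k))" .
  also have "?this \<longleftrightarrow> ?thesis"
  proof (rule landau_o.small.cong_ex)
    show "\<forall>\<^sub>F k in sequentially. (f k - (\<Sum>q\<le>g. c q * (real k * real k powi (- 2 * int q)))) * (1 / real k) =
        f k / real k - (\<Sum>q\<le>g. c q * (1 / real k ^ 2) ^ q)"
      using eventually_gt_at_top[of 0]
    proof eventually_elim
      case (elim k)
      have "(\<Sum>q\<le>g. c q * (real k * real k powi (- 2 * int q))) * (1 / real k) =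
          (\<Sum>q\<le>g. c q * (real k * real k powi (- 2 * int q) * (1 / real k)))"
        by (simp only: sum_distrib_right mult.assoc)
      also have "\<dots> = (\<Sum>q\<le>g. c q * (1 / real k ^ 2) ^ q)"
        by (simp only: pow[OF elim])
      finally show ?case by (simp only: left_diff_distrib) simp
    qed
    show "\<forall>\<^sub>F k in sequentially. real k * real k powi (- 2 * int g) * (1 / real k) = (1 / real k ^ 2) ^ g"
      using eventually_gt_at_top[of 0] by eventually_elim (rule pow)
  qed
  finally show ?thesis .
qed

text \<open>The arguments of the three partition functions tend to \<open>- s\<close> as
  \<open>k\<close> grows and so end up in the open set \<open>U\<close>, where one constant
  \<open>M\<close> serves for all. The factor \<open>w^(2-2h)\<close> in \<open>D\<close> converts
  powers of the size \<open>j = k w\<close> into powers of \<open>k\<close>.\<close>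

lemma recurrence_relation_from_uniform_bound:
  fixes \<nu>1 \<nu>2 :: nat and e z :: "nat \<Rightarrow> real \<Rightarrow> real \<Rightarrow> real" and D :: "nat \<Rightarrow> nat \<Rightarrow> real \<Rightarrow> real"
  defines "F \<equiv> \<lambda>k t1 t2. ln (partition_fn \<nu>1 \<nu>2 k t1 t2 / partition_fn \<nu>1 \<nu>2 k 0 0)"
  defines "a \<equiv> \<lambda>q. \<Sum>n\<le>q. 2 / fact (2 * n + 2) * D (q - n) (2 * n + 2) 1"
  assumes \<nu>: "\<nu>1 > 0" "\<nu>2 > 0"
    and rec: "\<And>\<xi>1 \<xi>2. \<xi>1 \<le> 0 \<Longrightarrow> \<xi>2 \<le> 0 \<Longrightarrow> recurrence_coeffs (weight \<nu>1 \<nu>2 \<xi>1 \<xi>2) (b \<xi>1 \<xi>2)"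
    and U: "open U" "(- s1, - s2) \<in> U" "s1 \<le> 0" "s2 \<le> 0"
    and bound: "\<And>t1 t2 k. (t1, t2) \<in> U \<Longrightarrow> k > 0 \<Longrightarrow>
      \<bar>F k t1 t2 - (\<Sum>h\<le>g + 2. e h t1 t2 * real k powi (2 - 2 * int h))\<bar> \<le> M * real k powi (2 - 2 * int (g + 2))"
    and S: "open S" "1 \<in> S"
    and der: "\<And>h n w. w \<in> S \<Longrightarrow> (D h n has_field_derivative D h (Suc n) w) (at w)"
    and D0: "\<And>h w. h \<le> g + 2 \<Longrightarrow> w \<in> S \<Longrightarrow>
      D h 0 w = w powi (2 - 2 * int h) * e h (- (w ^ (\<nu>1 - 1) * s1)) (- (w ^ (\<nu>2 - 1) * s2))"
    and z0: "z 0 0 0 = 1" "\<And>g. g \<ge> 1 \<Longrightarrow> z g 0 0 = 0"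
    and zexp: "has_asymp_expansion (\<lambda>k. (b (s1 / (2 * real k ^ (\<nu>1 - 1))) (s2 / (2 * real k ^ (\<nu>2 - 1))) k)\<^sup>2)
           (\<lambda>g k. real k * real k powi (- 2 * int g)) (\<lambda>g. z g s1 s2)"
    and zexp0: "has_asymp_expansion (\<lambda>k. (b 0 0 k)\<^sup>2)
           (\<lambda>g k. real k * real k powi (- 2 * int g)) (\<lambda>g. z g 0 0)"
  shows "z 0 s1 s2 = exp (a 0)"
    and "n < g \<Longrightarrow> real (Suc n) * z (Suc n) s1 s2 = (\<Sum>i\<le>n. real (Suc i) * a (Suc i) * z (n - i) s1 s2)"
proof -
  let ?t = "\<lambda>w. (- (w ^ (\<nu>1 - 1) * s1), - (w ^ (\<nu>2 - 1) * s2))"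
  have "open (S \<inter> {1/2<..} \<inter> ?t -` U)"
    using S(1) U(1) by (intro open_Int open_vimage open_greaterThan continuous_intros)
  moreover have "1 \<in> S \<inter> {1/2<..} \<inter> ?t -` U" using S(2) U(2) by simp
  \<comment> \<open>Staying above \<open>1/2\<close> bounds the negative powers of \<open>w\<close>;
    this gives the factor \<open>2 ^ (2 * g + 2)\<close> in \<open>K\<close>.\<close>
  ultimately obtain \<eta> where \<eta>: "\<eta> > 0" "cball 1 \<eta> \<subseteq> S \<inter> {1/2<..} \<inter> ?t -` U"
    by (meson open_contains_cball)
  then have near: "w \<in> S" "w > 1/2" "?t w \<in> U" if "w \<in> {1 - \<eta>..1 + \<eta>}" for w
    using that by (auto simp: cball_eq_atLeastAtMost)
  \<comment> \<open>The second difference is formulated for a function of real \<open>w\<close>. It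
    is evaluated at \<open>w = j / k\<close> with integral \<open>j\<close>, where the floor returns
    \<open>j\<close> itself.\<close>
  define \<Phi> where "\<Phi> k w = F (nat \<lfloor>real k * w\<rfloor>) (- (w ^ (\<nu>1 - 1) * s1)) (- (w ^ (\<nu>2 - 1) * s2))" for k w
  have \<Phi>: "\<Phi> k w = F j (- ((real j / real k) ^ (\<nu>1 - 1) * s1)) (- ((real j / real k) ^ (\<nu>2 - 1) * s2))"
    if "k > 0" "real j = real k * w" for k w j
  proof -
    have "w = real j / real k" using that by simp
    moreover have "nat \<lfloor>real k * w\<rfloor> = j" using that(2) by (metis floor_of_nat nat_int)
    ultimately show ?thesis by (simp add: \<Phi>_def)
  qed
  define K where "K = \<bar>M\<bar> * 2 ^ (2 * g + 2)"
  have \<Phi>_bound: "\<bar>\<Phi> k w - (\<Sum>h\<le>g + 2. D h 0 w * real k powi (2 - 2 * int h))\<bar> \<le> K * real k powi (2 - 2 * int (g + 2))"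
    if k: "k > 0" and j: "real j = real k * w" "j > 0" and w: "w \<in> {1 - \<eta>..1 + \<eta>}" for k j w
  proof -
    have w2: "w > 1/2" using near(2)[OF w] .
    have "D h 0 w * real k powi (2 - 2 * int h) =
        e h (- (w ^ (\<nu>1 - 1) * s1)) (- (w ^ (\<nu>2 - 1) * s2)) * real j powi (2 - 2 * int h)" if "h \<le> g + 2" for h
      using D0[OF that near(1)[OF w]] by (simp add: j(1) power_int_mult_distrib)
    then have sum: "(\<Sum>h\<le>g + 2. D h 0 w * real k powi (2 - 2 * int h)) =
        (\<Sum>h\<le>g + 2. e h (- (w ^ (\<nu>1 - 1) * s1)) (- (w ^ (\<nu>2 - 1) * s2)) * real j powi (2 - 2 * int h))"
      by (intro sum.cong) auto
    have wj: "real j / real k = w" using k j by simp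
    have "\<bar>\<Phi> k w - (\<Sum>h\<le>g + 2. D h 0 w * real k powi (2 - 2 * int h))\<bar> \<le> M * real j powi (2 - 2 * int (g + 2))"
      unfolding \<Phi>[OF k j(1)] sum wj by (rule bound[OF near(3)[OF w] j(2)])
    also have "\<dots> \<le> \<bar>M\<bar> * real j powi (2 - 2 * int (g + 2))"
      by (intro mult_right_mono) auto
    also have "real j powi (2 - 2 * int (g + 2)) = w powi (2 - 2 * int (g + 2)) * real k powi (2 - 2 * int (g + 2))"
      by (simp add: j(1) power_int_mult_distrib)
    also have "\<bar>M\<bar> * (w powi (2 - 2 * int (g + 2)) * real k powi (2 - 2 * int (g + 2))) \<le>
        \<bar>M\<bar> * (2 ^ (2 * g + 2) * real k powi (2 - 2 * int (g + 2)))"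
    proof (intro mult_left_mono mult_right_mono)
      have "2 - 2 * int (g + 2) = - int (2 * g + 2)" by simp
      then have "w powi (2 - 2 * int (g + 2)) = inverse w ^ (2 * g + 2)"
        by (simp only: power_int_minus power_int_of_nat power_inverse)
      also have "\<dots> \<le> 2 ^ (2 * g + 2)"
        using w2 by (intro power_mono) (auto simp: field_simps)
      finally show "w powi (2 - 2 * int (g + 2)) \<le> 2 ^ (2 * g + 2)" .
    qed auto
    finally show ?thesis by (simp only: K_def mult.assoc)
  qed
  have "\<forall>\<^sub>F k in sequentially. 1 / real k \<le> \<eta>"
    using order_tendstoD(2)[OF lim_1_over_n \<eta>(1)] by (rule eventually_mono) simp
  then have "\<forall>\<^sub>F k in sequentially. \<forall>w\<in>{1 - 1 / real k, 1, 1 + 1 / real k}.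
      \<bar>\<Phi> k w - (\<Sum>h\<le>g + 2. D h 0 w * real k powi (2 - 2 * int h))\<bar> \<le> K * real k powi (2 - 2 * int (g + 2))"
    using eventually_gt_at_top[of 1]
  proof eventually_elim
    case (elim k)
    show ?case
    proof
      fix w assume w: "w \<in> {1 - 1 / real k, 1, 1 + 1 / real k}"
      have "real (k - 1) = real k * (1 - 1 / real k)" "real k = real k * 1"
        "real (k + 1) = real k * (1 + 1 / real k)"
        using elim(2) by (simp_all add: of_nat_diff algebra_simps)
      with w obtain j where "real j = real k * w" "j > 0"
        using elim(2) by (metis (no_types, lifting) add_gr_0 empty_iff insert_iff less_numeral_extra(1) order.strict_trans zero_less_diff)
      moreover have "w \<in> {1 - \<eta>..1 + \<eta>}"
      proof -
        have "0 \<le> 1 / real k" by simp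
        then have "- \<eta> \<le> 1 / real k" "- (1 / real k) \<le> \<eta>" using elim(1) \<eta>(1) by linarith+
        then show ?thesis using w elim(1) \<eta>(1) by auto
      qed
      ultimately show "\<bar>\<Phi> k w - (\<Sum>h\<le>g + 2. D h 0 w * real k powi (2 - 2 * int h))\<bar> \<le>
          K * real k powi (2 - 2 * int (g + 2))"
        using elim(2) by (intro \<Phi>_bound) auto
    qed
  qed
  from second_difference_expansion[of \<eta> D \<Phi> g K, OF \<eta>(1) der[OF near(1)] this]
  obtain C where C: "\<forall>\<^sub>F k in sequentially.
      \<bar>\<Phi> k (1 + 1 / real k) - 2 * \<Phi> k 1 + \<Phi> k (1 - 1 / real k) - (\<Sum>q\<le>g. a q * (1 / real k ^ 2) ^ q)\<bar>
      \<le> C * (1 / real k ^ 2) ^ (g + 1)"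
    unfolding a_def by blast
  define \<xi>1 where "\<xi>1 k = s1 / (2 * real k ^ (\<nu>1 - 1))" for k :: nat
  define \<xi>2 where "\<xi>2 k = s2 / (2 * real k ^ (\<nu>2 - 1))" for k :: nat
  have \<xi>: "\<xi>1 k \<le> 0" "\<xi>2 k \<le> 0" for k
    using U(3,4) by (auto simp: \<xi>1_def \<xi>2_def divide_nonpos_nonneg)
  \<comment> \<open>The argument \<open>- (j/k)^(\<nu>-1) s\<close> equals
    \<open>- 2 \<xi> j^(\<nu>-1)\<close> with \<xi> depending on \<open>k\<close> only, while
    \<open>j\<close> runs through \<open>k-1\<close>, \<open>k\<close>, \<open>k+1\<close>.\<close>
  have toda: "\<Phi> k (1 + 1 / real k) - 2 * \<Phi> k 1 + \<Phi> k (1 - 1 / real k) =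
      ln ((b (\<xi>1 k) (\<xi>2 k) k)\<^sup>2) - ln ((b 0 0 k)\<^sup>2)" if k: "k > 1" for k
  proof -
    have "\<Phi> k w = F j (- 2 * \<xi>1 k * real j ^ (\<nu>1 - 1)) (- 2 * \<xi>2 k * real j ^ (\<nu>2 - 1))"
      if "real j = real k * w" for j w
      using \<Phi>[OF _ that] k by (simp add: \<xi>1_def \<xi>2_def power_divide mult.commute)
    note \<Phi>' = this
    have "\<Phi> k (1 + 1 / real k) = F (k + 1) (- 2 * \<xi>1 k * real (k + 1) ^ (\<nu>1 - 1)) (- 2 * \<xi>2 k * real (k + 1) ^ (\<nu>2 - 1))"
      by (rule \<Phi>') (use k in \<open>simp add: algebra_simps\<close>)
    moreover have "\<Phi> k 1 = F k (- 2 * \<xi>1 k * real k ^ (\<nu>1 - 1)) (- 2 * \<xi>2 k * real k ^ (\<nu>2 - 1))"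
      by (rule \<Phi>') simp
    moreover have "\<Phi> k (1 - 1 / real k) = F (k - 1) (- 2 * \<xi>1 k * real (k - 1) ^ (\<nu>1 - 1)) (- 2 * \<xi>2 k * real (k - 1) ^ (\<nu>2 - 1))"
      by (rule \<Phi>') (use k in \<open>simp add: of_nat_diff algebra_simps\<close>)
    ultimately show ?thesis
      using second_difference_ln_partition_fn[of \<nu>1 \<nu>2 b "\<xi>1 k" "\<xi>2 k" k, OF \<nu> rec \<xi> k]
      unfolding F_def by simp
  qed
  have bpos: "b \<eta>1 \<eta>2 k > 0" if "\<eta>1 \<le> 0" "\<eta>2 \<le> 0" "k > 0" for \<eta>1 \<eta>2 k
    using rec[OF that(1,2)] that(3) by (auto simp: recurrence_coeffs_def)
  define y where "y k = \<Phi> k (1 + 1 / real k) - 2 * \<Phi> k 1 + \<Phi> k (1 - 1 / real k)" for k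
  have u: "(\<lambda>k. (b (\<xi>1 k) (\<xi>2 k) k)\<^sup>2 / real k - (\<Sum>q\<le>g. z q s1 s2 * (1 / real k ^ 2) ^ q))
      \<in> o[sequentially](\<lambda>k. (1 / real k ^ 2) ^ g)"
    using has_asymp_expansion_divide_k[OF zexp] by (simp add: \<xi>1_def \<xi>2_def)
  have "(\<Sum>q\<le>g. z q 0 0 * (1 / real k ^ 2) ^ q) = 1" for k
    by (subst sum.atMost_shift) (simp add: z0)
  then have v: "(\<lambda>k. (b 0 0 k)\<^sup>2 / real k - 1) \<in> o[sequentially](\<lambda>k. (1 / real k ^ 2) ^ g)"
    using has_asymp_expansion_divide_k[OF zexp0, of g] by (simp only:)
  have x: "(\<lambda>k. 1 / real k ^ 2) \<longlonglongrightarrow> 0"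
    using tendsto_power[OF lim_1_over_n, of 2] by (simp add: power_one_over)
  have pos: "\<forall>\<^sub>F k in sequentially. 1 / real k ^ 2 > 0"
    using eventually_gt_at_top[of 0] by eventually_elim simp
  have uyv: "\<forall>\<^sub>F k in sequentially. (b (\<xi>1 k) (\<xi>2 k) k)\<^sup>2 / real k = exp (y k) * ((b 0 0 k)\<^sup>2 / real k)"
    using eventually_gt_at_top[of 1]
  proof eventually_elim
    case (elim k)
    then have "b (\<xi>1 k) (\<xi>2 k) k > 0" "b 0 0 k > 0" using bpos \<xi> by auto
    then show ?case unfolding y_def toda[OF elim] by (simp add: exp_diff)
  qed
  have yC: "\<forall>\<^sub>F k in sequentially. \<bar>y k - (\<Sum>q\<le>g. a q * (1 / real k ^ 2) ^ q)\<bar> \<le> C * (1 / real k ^ 2) ^ (g + 1)"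
    using C unfolding y_def .
  from exp_expansion_coeffs(1)[OF x pos yC v u uyv] show "z 0 s1 s2 = exp (a 0)" .
  from exp_expansion_coeffs(2)[OF x pos yC v u uyv]
  show "n < g \<Longrightarrow> real (Suc n) * z (Suc n) s1 s2 = (\<Sum>i\<le>n. real (Suc i) * a (Suc i) * z (n - i) s1 s2)" .
qed

text \<open>The relative remainder is a null sequence and hence bounded. The shift to
  \<open>Suc k\<close> leaves out \<open>k = 0\<close>, where a negative power takes a default
  value.\<close>

lemma asymp_expansion_bounded:
  assumes "has_asymp_expansion f (\<lambda>g k. real k powi (2 - 2 * int g)) c"
  shows "\<exists>M. \<forall>k. \<bar>(f (Suc k) - (\<Sum>h\<le>N. c h * real (Suc k) powi (2 - 2 * int h))) /
    real (Suc k) powi (2 - 2 * int N)\<bar> \<le> M"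
proof -
  let ?q = "\<lambda>k. (f k - (\<Sum>h\<le>N. c h * real k powi (2 - 2 * int h))) / real k powi (2 - 2 * int N)"
  have "?q \<longlonglongrightarrow> 0"
    using assms unfolding has_asymp_expansion_def by (intro smalloD_tendsto) blast
  then have "(\<lambda>k. ?q (Suc k)) \<longlonglongrightarrow> 0" by (rule LIMSEQ_Suc)
  then have "Bseq (\<lambda>k. ?q (Suc k))" by (intro convergent_imp_Bseq convergentI)
  then show ?thesis unfolding Bseq_def real_norm_def by blast
qed

text \<open>The remainders divided by their order are continuous in \<open>t\<close> and, for each
  \<open>t\<close>, bounded in \<open>k\<close>, so the Baire argument applies. The closed square
  sits inside the part of the quadrant where the expansion holds and inside the polydisc of the
  \<open>e h\<close>.\<close>

lemma partition_fn_uniform_expansion: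
  fixes \<nu>1 \<nu>2 :: nat and e :: "nat \<Rightarrow> real \<Rightarrow> real \<Rightarrow> real"
  defines "F \<equiv> \<lambda>k t1 t2. ln (partition_fn \<nu>1 \<nu>2 k t1 t2 / partition_fn \<nu>1 \<nu>2 k 0 0)"
  assumes \<nu>: "\<nu>1 > 0" "\<nu>2 > 0"
    and rec: "\<And>\<xi>1 \<xi>2. \<xi>1 \<le> 0 \<Longrightarrow> \<xi>2 \<le> 0 \<Longrightarrow> recurrence_coeffs (weight \<nu>1 \<nu>2 \<xi>1 \<xi>2) (b \<xi>1 \<xi>2)"
    and r: "\<And>h. h \<le> N \<Longrightarrow> \<exists>c. has_double_series r c (e h)"
    and \<delta>: "\<And>t1 t2. 0 \<le> t1 \<Longrightarrow> t1 < \<delta> \<Longrightarrow> 0 \<le> t2 \<Longrightarrow> t2 < \<delta> \<Longrightarrow>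
      has_asymp_expansion (\<lambda>k. F k t1 t2) (\<lambda>g k. real k powi (2 - 2 * int g)) (\<lambda>g. e g t1 t2)"
    and \<rho>: "0 < \<rho>" "\<rho> < r" "\<rho> < \<delta>"
  shows "\<exists>U M. open U \<and> U \<noteq> {} \<and> U \<subseteq> {\<rho> / 2..\<rho>} \<times> {\<rho> / 2..\<rho>} \<and>
    (\<forall>t1 t2 k. (t1, t2) \<in> U \<longrightarrow> k > 0 \<longrightarrow>
      \<bar>F k t1 t2 - (\<Sum>h\<le>N. e h t1 t2 * real k powi (2 - 2 * int h))\<bar> \<le> M * real k powi (2 - 2 * int N))"
proof -
  let ?S = "{\<rho> / 2..\<rho>} \<times> {\<rho> / 2..\<rho>}"
  define f where "f k t = (F (Suc k) (fst t) (snd t) - (\<Sum>h\<le>N. e h (fst t) (snd t) * real (Suc k) powi (2 - 2 * int h))) /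
    real (Suc k) powi (2 - 2 * int N)" for k and t :: "real \<times> real"
  have "closed ?S" by (intro closed_Times closed_real_atLeastAtMost)
  moreover have "?S \<noteq> {}" using \<rho>(1) by auto
  moreover have "?S \<subseteq> closure (interior ?S)"
    using \<rho>(1) by (simp add: interior_Times closure_Times)
  moreover have "continuous_on ?S (f k)" for k
  proof -
    have "continuous_on ?S (\<lambda>(t1, t2). F (Suc k) t1 t2)"
      unfolding F_def
      by (rule continuous_on_subset[OF continuous_on_ln_partition_fn_ratio[OF \<nu> _ rec]]) (use \<rho>(1) in auto)
    moreover have "continuous_on ?S (\<lambda>(t1, t2). e h t1 t2)" if h: "h \<le> N" for h
    proof -
      obtain c where c: "has_double_series r c (e h)" using r[OF h] by blast
      show ?thesis
        by (rule continuous_on_subset[OF has_double_series_continuous_on[OF c]]) (use \<rho> in auto)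
    qed
    ultimately show ?thesis
      unfolding f_def case_prod_unfold
      by (intro continuous_on_divide continuous_on_diff continuous_on_sum continuous_on_mult continuous_on_const) auto
  qed
  moreover have "\<exists>M. \<forall>k. \<bar>f k t\<bar> \<le> M" if "t \<in> ?S" for t
    unfolding f_def
    by (rule asymp_expansion_bounded, rule \<delta>) (use that \<rho> in auto)
  ultimately have "\<exists>U M. open U \<and> U \<noteq> {} \<and> U \<subseteq> ?S \<and> (\<forall>x\<in>U. \<forall>k. \<bar>f k x\<bar> \<le> M)"
    by (rule pointwise_bounded_imp_uniformly_bounded_on_open)
  then obtain U M where U: "open U" "U \<noteq> {}" "U \<subseteq> ?S" "\<And>x k. x \<in> U \<Longrightarrow> \<bar>f k x\<bar> \<le> M"
    by blast
  show ?thesis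
  proof (intro exI[of _ U] exI[of _ M] conjI allI impI U)
    fix t1 t2 :: real and k :: nat
    assume t: "(t1, t2) \<in> U" and k: "k > 0"
    then obtain j where j: "k = Suc j" by (cases k) auto
    have pos: "real k powi (2 - 2 * int N) > 0" using k by simp
    have "\<bar>f j (t1, t2)\<bar> \<le> M" using U(4)[OF t] .
    then show "\<bar>F k t1 t2 - (\<Sum>h\<le>N. e h t1 t2 * real k powi (2 - 2 * int h))\<bar> \<le> M * real k powi (2 - 2 * int N)"
      using pos unfolding f_def j[symmetric] by (simp add: abs_divide divide_le_eq)
  qed
qed

theorem theorem5p4:
  fixes \<nu>1 \<nu>2 :: nat
    and e z :: "nat \<Rightarrow> real \<Rightarrow> real \<Rightarrow> real"
    and b :: "real \<Rightarrow> real \<Rightarrow> nat \<Rightarrow> real"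
  assumes "\<nu>1 > 0" and "\<nu>2 > 0" and "\<nu>1 \<noteq> \<nu>2"
    and e_analytic: "\<And>g. analytic_near_0 (e g)"
    and e_expansion:
      "\<exists>\<delta>>0. \<forall>t1 t2. 0 \<le> t1 \<longrightarrow> t1 < \<delta> \<longrightarrow> 0 \<le> t2 \<longrightarrow> t2 < \<delta> \<longrightarrow>
         has_asymp_expansion
           (\<lambda>k. ln (partition_fn \<nu>1 \<nu>2 k t1 t2 / partition_fn \<nu>1 \<nu>2 k 0 0))
           (\<lambda>g k. real k powi (2 - 2 * int g)) (\<lambda>g. e g t1 t2)"
    and b_recurrence:
      "\<And>\<xi>1 \<xi>2. \<xi>1 \<le> 0 \<Longrightarrow> \<xi>2 \<le> 0 \<Longrightarrow> recurrence_coeffs (weight \<nu>1 \<nu>2 \<xi>1 \<xi>2) (b \<xi>1 \<xi>2)"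
    and z_analytic: "\<And>g. analytic_near_0 (z g)"
    and z_origin: "z 0 0 0 = 1" "\<And>g. g \<ge> 1 \<Longrightarrow> z g 0 0 = 0"
    and z_expansion:
      "\<exists>\<delta>>0. \<forall>s1 s2. - \<delta> < s1 \<longrightarrow> s1 \<le> 0 \<longrightarrow> - \<delta> < s2 \<longrightarrow> s2 \<le> 0 \<longrightarrow>
         has_asymp_expansion
           (\<lambda>k. (b (s1 / (2 * real k ^ (\<nu>1 - 1))) (s2 / (2 * real k ^ (\<nu>2 - 1))) k)\<^sup>2)
           (\<lambda>g k. real k * real k powi (- 2 * int g)) (\<lambda>g. z g s1 s2)"
  shows "\<forall>g. \<exists>\<delta>>0. \<forall>s1 s2. \<bar>s1\<bar> < \<delta> \<longrightarrow> \<bar>s2\<bar> < \<delta> \<longrightarrow>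
    (deriv ^^ 2)
      (\<lambda>w::real. w powi (2 - 2 * int g) *
         e g (- (w ^ (\<nu>1 - 1)) * s1) (- (w ^ (\<nu>2 - 1)) * s2)) 1 =
    - (\<Sum>n=1..g. 2 / fact (2 * n + 2) *
         (deriv ^^ (2 * n + 2))
           (\<lambda>w::real. w powi (2 - 2 * int (g - n)) *
              e (g - n) (- (w ^ (\<nu>1 - 1)) * s1) (- (w ^ (\<nu>2 - 1)) * s2)) 1)
    + fps_nth (fps_log (Abs_fps (\<lambda>n. z n s1 s2))) g"
proof
  fix g :: nat
  let ?N = "g + 2"
  obtain \<delta>e where \<delta>e: "\<delta>e > 0" "\<And>t1 t2. 0 \<le> t1 \<Longrightarrow> t1 < \<delta>e \<Longrightarrow> 0 \<le> t2 \<Longrightarrow> t2 < \<delta>e \<Longrightarrow>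
         has_asymp_expansion
           (\<lambda>k. ln (partition_fn \<nu>1 \<nu>2 k t1 t2 / partition_fn \<nu>1 \<nu>2 k 0 0))
           (\<lambda>g k. real k powi (2 - 2 * int g)) (\<lambda>g. e g t1 t2)"
    using e_expansion by auto
  obtain \<delta>z where \<delta>z: "\<delta>z > 0" "\<And>s1 s2. - \<delta>z < s1 \<Longrightarrow> s1 \<le> 0 \<Longrightarrow> - \<delta>z < s2 \<Longrightarrow> s2 \<le> 0 \<Longrightarrow>
         has_asymp_expansion
           (\<lambda>k. (b (s1 / (2 * real k ^ (\<nu>1 - 1))) (s2 / (2 * real k ^ (\<nu>2 - 1))) k)\<^sup>2)
           (\<lambda>g k. real k * real k powi (- 2 * int g)) (\<lambda>g. z g s1 s2)"
    using z_expansion by auto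
  obtain re where re: "re > 0" "\<forall>h\<le>?N. \<exists>c. has_double_series re c (e h)"
    using common_double_series_radius[of e, OF e_analytic] by blast
  obtain rz where rz: "rz > 0" "\<forall>h\<le>g. \<exists>c. has_double_series rz c (z h)"
    using common_double_series_radius[of z, OF z_analytic] by blast
  define r where "r = min re rz"
  have r: "r > 0" "\<And>h. h \<le> ?N \<Longrightarrow> \<exists>c. has_double_series r c (e h)"
    "\<And>h. h \<le> g \<Longrightarrow> \<exists>c. has_double_series r c (z h)"
    using re rz has_double_series_mono unfolding r_def by (meson min_less_iff_conj min.cobounded1 min.cobounded2)+

  \<comment> \<open>\<open>G n\<close> is the \<open>n\<close>-th derivative in \<open>w\<close>
    with its power of \<open>w\<close> split off: a double series in the dilated arguments, whose
    value at \<open>w = 1\<close> is the derivative occurring in the claim.\<close>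
  define P where "P h G \<longleftrightarrow> G 0 = (\<lambda>s1 s2. e h (- s1) (- s2)) \<and> (\<forall>n. \<exists>c. has_double_series r c (G n)) \<and>
    (\<forall>n w s1 s2. w > 0 \<longrightarrow> \<bar>w ^ (\<nu>1 - 1) * s1\<bar> < r \<longrightarrow> \<bar>w ^ (\<nu>2 - 1) * s2\<bar> < r \<longrightarrow>
      ((\<lambda>w. w powi (2 - 2 * int h - int n) * G n (w ^ (\<nu>1 - 1) * s1) (w ^ (\<nu>2 - 1) * s2)) has_field_derivative
        w powi (2 - 2 * int h - int (Suc n)) * G (Suc n) (w ^ (\<nu>1 - 1) * s1) (w ^ (\<nu>2 - 1) * s2)) (at w))"
    for h and G :: "nat \<Rightarrow> real \<Rightarrow> real \<Rightarrow> real"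
  have "\<exists>G. h \<le> ?N \<longrightarrow> P h G" for h
  proof (cases "h \<le> ?N")
    case True
    then obtain c where "has_double_series r c (e h)" using r(2) by blast
    note reflected = has_double_series_reflect[OF this]
    have "\<exists>G. P h G"
    proof (rule has_double_series_iterated_derivative[OF reflected, of "\<nu>1 - 1" "\<nu>2 - 1" "2 - 2 * int h"])
      fix G assume "G 0 = (\<lambda>s1 s2. e h (- s1) (- s2))" "\<And>n. \<exists>c. has_double_series r c (G n)"
        "\<And>n w s1 s2. w > 0 \<Longrightarrow> \<bar>w ^ (\<nu>1 - 1) * s1\<bar> < r \<Longrightarrow> \<bar>w ^ (\<nu>2 - 1) * s2\<bar> < r \<Longrightarrow>
          ((\<lambda>w. w powi (2 - 2 * int h - int n) * G n (w ^ (\<nu>1 - 1) * s1) (w ^ (\<nu>2 - 1) * s2)) has_field_derivative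
            w powi (2 - 2 * int h - int (Suc n)) * G (Suc n) (w ^ (\<nu>1 - 1) * s1) (w ^ (\<nu>2 - 1) * s2)) (at w)"
      then show ?thesis unfolding P_def by (intro exI[of _ G] conjI allI impI)
    qed
    then show ?thesis by blast
  qed auto
  then have "\<forall>h. \<exists>G. h \<le> ?N \<longrightarrow> P h G" by (rule allI)
  from choice[OF this] obtain G where G: "\<And>h. h \<le> ?N \<Longrightarrow> P h (G h)" by blast
  have G0: "G h 0 = (\<lambda>s1 s2. e h (- s1) (- s2))" and Gds: "\<exists>c. has_double_series r c (G h n)"
    if "h \<le> ?N" for h n
    using G[OF that] unfolding P_def by blast+
  have Gder: "((\<lambda>w. w powi (2 - 2 * int h - int n) * G h n (w ^ (\<nu>1 - 1) * s1) (w ^ (\<nu>2 - 1) * s2)) has_field_derivative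
        w powi (2 - 2 * int h - int (Suc n)) * G h (Suc n) (w ^ (\<nu>1 - 1) * s1) (w ^ (\<nu>2 - 1) * s2)) (at w)"
    if "h \<le> ?N" "w > 0" "\<bar>w ^ (\<nu>1 - 1) * s1\<bar> < r" "\<bar>w ^ (\<nu>2 - 1) * s2\<bar> < r" for h n w s1 s2
    using G[OF that(1)] that(2-) unfolding P_def by blast

  define S where "S s1 s2 = {w. w > 0 \<and> \<bar>w ^ (\<nu>1 - 1) * s1\<bar> < r \<and> \<bar>w ^ (\<nu>2 - 1) * s2\<bar> < r}" for s1 s2 :: real
  have openS: "open (S s1 s2)" for s1 s2
    unfolding S_def by (intro open_Collect_conj open_Collect_less continuous_intros)
  \<comment> \<open>\<open>recurrence_relation_from_uniform_bound\<close> wants the chain of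
    derivatives for every \<open>h\<close>, but the common radius covers \<open>h \<le> ?N\<close>;
    above that, \<open>0\<close> is a default satisfying the chain trivially.\<close>
  define D where "D s1 s2 h n w = (if h \<le> ?N then
      w powi (2 - 2 * int h - int n) * G h n (w ^ (\<nu>1 - 1) * s1) (w ^ (\<nu>2 - 1) * s2) else 0)" for s1 s2 h n w
  have Dder: "(D s1 s2 h n has_field_derivative D s1 s2 h (Suc n) w) (at w)" if "w \<in> S s1 s2" for s1 s2 h n w
  proof (cases "h \<le> ?N")
    case True
    then have "D s1 s2 h n = (\<lambda>w. w powi (2 - 2 * int h - int n) * G h n (w ^ (\<nu>1 - 1) * s1) (w ^ (\<nu>2 - 1) * s2))" for n
      by (simp add: D_def fun_eq_iff)
    then show ?thesis using Gder[OF True] that by (simp add: S_def del: of_nat_Suc)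
  next
    case False
    then have "D s1 s2 h n = (\<lambda>_. 0)" for n by (simp add: D_def fun_eq_iff)
    then show ?thesis by simp
  qed
  have D1: "D s1 s2 h n 1 = G h n s1 s2" if "h \<le> ?N" for s1 s2 h n
    using that by (simp add: D_def)
  have D0: "D s1 s2 h 0 = (\<lambda>w. w powi (2 - 2 * int h) * e h (- (w ^ (\<nu>1 - 1) * s1)) (- (w ^ (\<nu>2 - 1) * s2)))"
    if "h \<le> ?N" for s1 s2 h
    using that by (simp add: D_def G0 fun_eq_iff)
  have deriv: "(deriv ^^ n) (\<lambda>w. w powi (2 - 2 * int h) * e h (- (w ^ (\<nu>1 - 1)) * s1) (- (w ^ (\<nu>2 - 1)) * s2)) 1 =
      G h n s1 s2" if "h \<le> ?N" "\<bar>s1\<bar> < r" "\<bar>s2\<bar> < r" for h n s1 s2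
  proof -
    have "1 \<in> S s1 s2" using that by (simp add: S_def)
    from funpow_deriv_eqI[OF openS this, of "D s1 s2 h" n] Dder show ?thesis
      by (simp add: D0[OF that(1)] D1[OF that(1)])
  qed

  \<comment> \<open>The coefficient of \<open>k^(-2q)\<close> in the second difference:
    \<open>e (q - n)\<close> contributes through its Taylor term of order \<open>2n+2\<close>. The
    claim amounts to \<open>a g\<close> being the coefficient of the formal logarithm.\<close>
  define a where "a q s1 s2 = (\<Sum>n\<le>q. 2 / fact (2 * n + 2) * G (q - n) (2 * n + 2) s1 s2)" for q s1 s2
  have a_hol: "sep_holomorphic r (a q)" if "q \<le> g" for q
  proof -
    have "sep_holomorphic r (G (q - n) (2 * n + 2))" if "n \<le> q" for n
    proof -
      have "q - n \<le> ?N" using \<open>q \<le> g\<close> by linarith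
      then obtain c where "has_double_series r c (G (q - n) (2 * n + 2))"
        using Gds by blast
      then show ?thesis by (rule has_double_series_imp_sep_holomorphic)
    qed
    then show ?thesis unfolding a_def
      by (intro sep_holomorphic_sum sep_holomorphic_mult sep_holomorphic_const) auto
  qed
  have z_hol: "sep_holomorphic r (z q)" if "q \<le> g" for q
    using r(3)[OF that] has_double_series_imp_sep_holomorphic by blast

  define \<rho> where "\<rho> = min (min r \<delta>e) \<delta>z / 2"
  have \<rho>: "0 < \<rho>" "\<rho> < r" "\<rho> < \<delta>e" "\<rho> < \<delta>z" using r(1) \<delta>e(1) \<delta>z(1) by (auto simp: \<rho>_def)
  obtain U M where U: "open U" "U \<noteq> {}" "U \<subseteq> {\<rho> / 2..\<rho>} \<times> {\<rho> / 2..\<rho>}"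
    and bound: "\<And>t1 t2 k. (t1, t2) \<in> U \<Longrightarrow> k > 0 \<Longrightarrow>
      \<bar>ln (partition_fn \<nu>1 \<nu>2 k t1 t2 / partition_fn \<nu>1 \<nu>2 k 0 0) -
        (\<Sum>h\<le>?N. e h t1 t2 * real k powi (2 - 2 * int h))\<bar> \<le> M * real k powi (2 - 2 * int ?N)"
    using partition_fn_uniform_expansion[of \<nu>1 \<nu>2 b ?N r e \<delta>e \<rho>, OF assms(1,2) b_recurrence r(2) \<delta>e(2) \<rho>(1-3)]
    by blast
  have local: "z 0 s1 s2 = exp (a 0 s1 s2)"
    "n < g \<Longrightarrow> real (Suc n) * z (Suc n) s1 s2 = (\<Sum>i\<le>n. real (Suc i) * a (Suc i) s1 s2 * z (n - i) s1 s2)"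
    if s: "(- s1, - s2) \<in> U" for s1 s2 n
  proof -
    have s': "s1 \<le> 0" "s2 \<le> 0" "- \<delta>z < s1" "- \<delta>z < s2" "\<bar>s1\<bar> < r" "\<bar>s2\<bar> < r"
      using s U(3) \<rho> by auto
    have 1: "1 \<in> S s1 s2" using s' by (simp add: S_def)
    have aD: "(\<Sum>n\<le>q. 2 / fact (2 * n + 2) * D s1 s2 (q - n) (2 * n + 2) 1) = a q s1 s2" if "q \<le> g" for q
      unfolding a_def using that by (intro sum.cong) (auto simp: D1)
    have zexp0: "has_asymp_expansion (\<lambda>k. (b 0 0 k)\<^sup>2)
           (\<lambda>g k. real k * real k powi (- 2 * int g)) (\<lambda>g. z g 0 0)"
      using \<delta>z(2)[of 0 0] \<delta>z(1) by simp
    note R = recurrence_relation_from_uniform_bound[OF assms(1,2) b_recurrence U(1) s s'(1,2) bound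
        openS 1 Dder D0[THEN fun_cong] z_origin \<delta>z(2)[OF s'(3,1,4,2)] zexp0]
    show "z 0 s1 s2 = exp (a 0 s1 s2)" using R(1) aD[of 0] by simp
    show "real (Suc n) * z (Suc n) s1 s2 = (\<Sum>i\<le>n. real (Suc i) * a (Suc i) s1 s2 * z (n - i) s1 s2)" if "n < g"
    proof -
      have "real (Suc n) * z (Suc n) s1 s2 = (\<Sum>i\<le>n. real (Suc i) *
          (\<Sum>m\<le>Suc i. 2 / fact (2 * m + 2) * D s1 s2 (Suc i - m) (2 * m + 2) 1) * z (n - i) s1 s2)"
        by (rule R(2)) (assumption | rule that)+
      also have "\<dots> = (\<Sum>i\<le>n. real (Suc i) * a (Suc i) s1 s2 * z (n - i) s1 s2)"
        using that by (intro sum.cong refl) (simp only: aD atMost_iff Suc_le_eq le_less_trans)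
      finally show ?thesis .
    qed
  qed
  \<comment> \<open>\<open>sep_holomorphic_eqI\<close> works on boxes, so a product set is taken
    inside \<open>U\<close>; reflection then passes from \<open>t\<close> to
    \<open>s = - t\<close>.\<close>
  obtain t1 t2 A B where AB: "open A" "open B" "t1 \<in> A" "t2 \<in> B" "A \<times> B \<subseteq> U"
  proof -
    obtain t where t: "t \<in> U" using U(2) by auto
    from open_prod_elim[OF U(1) t] obtain A B where "open A" "open B" "t \<in> A \<times> B" "A \<times> B \<subseteq> U" .
    then show thesis using that[of A B "fst t" "snd t"] by (simp add: mem_Times_iff)
  qed
  obtain \<epsilon>1 \<epsilon>2 where \<epsilon>: "\<epsilon>1 > 0" "ball t1 \<epsilon>1 \<subseteq> A" "\<epsilon>2 > 0" "ball t2 \<epsilon>2 \<subseteq> B"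
    using AB by (meson openE)
  have box: "(- s1, - s2) \<in> U" if "- t1 - \<epsilon>1 < s1" "s1 < - t1 + \<epsilon>1" "- t2 - \<epsilon>2 < s2" "s2 < - t2 + \<epsilon>2" for s1 s2
  proof -
    have "- s1 \<in> ball t1 \<epsilon>1" "- s2 \<in> ball t2 \<epsilon>2" using that by (auto simp: dist_real_def)
    then have "(- s1, - s2) \<in> A \<times> B" using \<epsilon>(2,4) by blast
    then show ?thesis using AB(5) by blast
  qed
  have Ur: "x \<in> {- r<..<r}" "y \<in> {- r<..<r}" if "(- x, - y) \<in> U" for x y
    using that U(3) \<rho> by auto
  have boxr: "{- t1 - \<epsilon>1<..<- t1 + \<epsilon>1} \<subseteq> {- r<..<r}" "{- t2 - \<epsilon>2<..<- t2 + \<epsilon>2} \<subseteq> {- r<..<r}"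
    using \<epsilon>(1,3) by (intro subsetI Ur(1)[where y = "- t2"] Ur(2)[where x = "- t1"] box; simp)+
  have ne: "- t1 - \<epsilon>1 < - t1 + \<epsilon>1" "- t2 - \<epsilon>2 < - t2 + \<epsilon>2" using \<epsilon>(1,3) by auto
  \<comment> \<open>The exponential is entire, so this relation continues without any choice of
    branch. It makes \<open>z 0\<close> positive at all real points of the polydisc, as
    \<open>fps_log_nth_eqI\<close> demands.\<close>
  have global0: "z 0 s1 s2 = exp (a 0 s1 s2)" if "\<bar>s1\<bar> < r" "\<bar>s2\<bar> < r" for s1 s2
    by (rule sep_holomorphic_eqI[OF z_hol sep_holomorphic_exp[OF a_hol] boxr(1) ne(1) boxr(2) ne(2) _ that])
      (use local(1) box in auto)
  have global: "real (Suc n) * z (Suc n) s1 s2 = (\<Sum>i\<le>n. real (Suc i) * a (Suc i) s1 s2 * z (n - i) s1 s2)"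
    if "n < g" "\<bar>s1\<bar> < r" "\<bar>s2\<bar> < r" for n s1 s2
  proof (rule sep_holomorphic_eqI[OF _ _ boxr(1) ne(1) boxr(2) ne(2) _ that(2,3)])
    show "sep_holomorphic r (\<lambda>s1 s2. real (Suc n) * z (Suc n) s1 s2)"
      using that(1) by (intro sep_holomorphic_mult sep_holomorphic_const z_hol) auto
    show "sep_holomorphic r (\<lambda>s1 s2. \<Sum>i\<le>n. real (Suc i) * a (Suc i) s1 s2 * z (n - i) s1 s2)"
      using that(1) by (intro sep_holomorphic_sum sep_holomorphic_mult sep_holomorphic_const z_hol a_hol) auto
  qed (rule local(2)[OF box that(1)])

  show "\<exists>\<delta>>0. \<forall>s1 s2. \<bar>s1\<bar> < \<delta> \<longrightarrow> \<bar>s2\<bar> < \<delta> \<longrightarrow>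
    (deriv ^^ 2)
      (\<lambda>w::real. w powi (2 - 2 * int g) *
         e g (- (w ^ (\<nu>1 - 1)) * s1) (- (w ^ (\<nu>2 - 1)) * s2)) 1 =
    - (\<Sum>n=1..g. 2 / fact (2 * n + 2) *
         (deriv ^^ (2 * n + 2))
           (\<lambda>w::real. w powi (2 - 2 * int (g - n)) *
              e (g - n) (- (w ^ (\<nu>1 - 1)) * s1) (- (w ^ (\<nu>2 - 1)) * s2)) 1)
    + fps_nth (fps_log (Abs_fps (\<lambda>n. z n s1 s2))) g"
  proof (intro exI[of _ r] conjI allI impI)
    show "r > 0" by (rule r(1))
    fix s1 s2 :: real assume s: "\<bar>s1\<bar> < r" "\<bar>s2\<bar> < r"
    have "fps_nth (fps_log (Abs_fps (\<lambda>n. z n s1 s2))) g = a g s1 s2"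
      using global0[OF s] by (intro fps_log_nth_eqI[where a = "\<lambda>q. a q s1 s2" and g = g]) (simp_all add: global[OF _ s] del: of_nat_Suc)
    \<comment> \<open>The summand \<open>n = 0\<close> has the factor \<open>2/2! = 1\<close> and is
      the left side of the claim; the others form the sum that is subtracted there.\<close>
    also have "a g s1 s2 = G g 2 s1 s2 + (\<Sum>n=1..g. 2 / fact (2 * n + 2) * G (g - n) (2 * n + 2) s1 s2)"
      unfolding a_def atLeast0AtMost[symmetric] by (subst sum.atLeast_Suc_atMost) (simp_all add: numeral_2_eq_2)
    finally have log: "fps_nth (fps_log (Abs_fps (\<lambda>n. z n s1 s2))) g =
        G g 2 s1 s2 + (\<Sum>n=1..g. 2 / fact (2 * n + 2) * G (g - n) (2 * n + 2) s1 s2)" .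
    have sum: "(\<Sum>n=1..g. 2 / fact (2 * n + 2) *
         (deriv ^^ (2 * n + 2))
           (\<lambda>w::real. w powi (2 - 2 * int (g - n)) *
              e (g - n) (- (w ^ (\<nu>1 - 1)) * s1) (- (w ^ (\<nu>2 - 1)) * s2)) 1) =
      (\<Sum>n=1..g. 2 / fact (2 * n + 2) * G (g - n) (2 * n + 2) s1 s2)"
      by (intro sum.cong refl arg_cong2[where f = "(*)"] deriv s) auto
    have "(deriv ^^ 2)
      (\<lambda>w::real. w powi (2 - 2 * int g) *
         e g (- (w ^ (\<nu>1 - 1)) * s1) (- (w ^ (\<nu>2 - 1)) * s2)) 1 = G g 2 s1 s2"
      by (rule deriv[OF _ s]) simp
    then show "(deriv ^^ 2)
      (\<lambda>w::real. w powi (2 - 2 * int g) *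
         e g (- (w ^ (\<nu>1 - 1)) * s1) (- (w ^ (\<nu>2 - 1)) * s2)) 1 =
      - (\<Sum>n=1..g. 2 / fact (2 * n + 2) *
         (deriv ^^ (2 * n + 2))
           (\<lambda>w::real. w powi (2 - 2 * int (g - n)) *
              e (g - n) (- (w ^ (\<nu>1 - 1)) * s1) (- (w ^ (\<nu>2 - 1)) * s2)) 1)
      + fps_nth (fps_log (Abs_fps (\<lambda>n. z n s1 s2))) g"
      unfolding sum log by simp
  qed
qed

end
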